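(* Let $\mathbb{F}$ be a field and let $L$ be a nilpotent symplectic alternating algebra over $\mathbb{F}$ of dimension $10$ with an isotropic center of dimension $2$ that is of class $7$ and has the further properties that $L^{4}L^{3}\neq L^{7}$, $L^{5}L^{2}\leq L^{4}L^{3}$ and $UL^{2}$ is $1$-dimensional, where $U=U(L)$ is the characteristic ideal defined in the context. Then $L$ can be given by a presentation of the form $$\mathcal{P}_{10}^{(2,5)}(r):\ (x_{2}y_{3},y_{5})=r,\ (x_{3}y_{4},y_{5})=1,\ (x_{1}y_{2},y_{5})=1,\ (y_{1}y_{2},y_{3})=1,$$ where $r\in\mathbb{F}$, $r\neq 0$. Furthermore, for $r,s\in\mathbb{F}^{*}$, two such presentations $\mathcal{P}_{10}^{(2,5)}(r)$ and $\mathcal{P}_{10}^{(2,5)}(s)$ describe the same algebra (up to isomorphism) if and only if $s/r\in(\mathbb{F}^{*})^{3}$. Conversely, any algebra with such a presentation has the properties stated.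
   Context: A symplectic alternating algebra (SAA) over a field $\mathbb{F}$ is a finite-dimensional $\mathbb{F}$-vector space $L$ with a non-degenerate alternating bilinear form $(\cdot,\cdot)$ and a bilinear alternating product $L\times L\to L$, $(x,y)\mapsto xy$ (so $xx=0$), such that $(xy,z)=(yz,x)$ for all $x,y,z\in L$. Consequently $(u,v,w)\mapsto (uv,w)$ is an alternating trilinear form, and by non-degeneracy it determines the product. An isomorphism of SAAs is a linear bijection preserving both the product and the form. For subspaces $A,B\le L$, $AB$ denotes the linear span of all products $ab$ with $a\in A$, $b\in B$. Put $L^{1}=L$, $L^{k+1}=L^{k}L$; $L$ is nilpotent if $L^{k+1}=0$ for some $k$, and the smallest such $k$ is its (nilpotence) class. The center is $Z(L)=\{z\in L: zx=0 \text{ for all } x\in L\}$. A subspace $A$ is isotropic if $(u,v)=0$ for all $u,v\in A$. $\mathbb{F}^{*}=\mathbb{F}\setminus\{0\}$ and $(\mathbb{F}^{*})^{m}=\{a^{m}:a\in\mathbb{F}^{*}\}$. A standard basis of a $10$-dimensional $L$ is a basis $x_{1},y_{1},\ldots,x_{5},y_{5}$ with $(x_i,x_j)=(y_i,y_j)=0$ and $(x_i,y_j)=\delta_{ij}$. A nilpotent presentation lists values of the triples $(x_iy_j,y_k)$ and $(y_iy_j,y_k)$ with $1\le i<j<k\le 5$ with respect to a standard basis. By convention, all triple values $(uv,w)$ of basis vectors $u,v,w$ which do not follow from the listed ones by the alternating property are $0$. Such a presentation determines an SAA up to isomorphism. Definition of $U$: let $L$ be a nilpotent SAA of dimension $10$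 and class $7$ with isotropic center of dimension $2$ (then $L^4L^3$ is a $2$-dimensional subspace of $L^6$). Put $I_{1}=L^{5}L^{2}$, $I_{2}=L^{7}$, $I_{3}=L^{6}$, and let $k$ be the smallest index such that $I_{k}\cap L^{4}L^{3}\neq\{0\}$. Then $U=\{x\in L^{4}: xL^{3}\leq I_{k}\}$, a characteristic ideal of dimension $5$. *)

theory Defs
  imports "HOL-Analysis.Finite_Cartesian_Product"
begin

text \<open>
  The underlying vector space of an algebra is the whole type \<open>'v\<close>; only the operations are
  recorded. The additive structure of \<open>'v\<close> comes from the class \<open>ab_group_add\<close>.
\<close>

record ('f, 'v) saa_data =
  smult :: "'f \<Rightarrow> 'v \<Rightarrow> 'v"
  form :: "'v \<Rightarrow> 'v \<Rightarrow> 'f"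
  mult :: "'v \<Rightarrow> 'v \<Rightarrow> 'v"  (infixl "\<cdot>\<index>" 70)

locale saa =
  fixes L :: "('f::field, 'v::ab_group_add) saa_data" (structure)
  assumes vector_space: "vector_space (smult L)"
    and finite_dimensional: "\<exists>B. finite B \<and> module.span (smult L) B = UNIV"
    and form_linear_left: "Vector_Spaces.linear (smult L) (*) (\<lambda>x. form L x y)"
    and form_linear_right: "Vector_Spaces.linear (smult L) (*) (\<lambda>y. form L x y)"
    and form_alternating: "form L x x = 0"
    and form_nondegenerate: "(\<And>y. form L x y = 0) \<Longrightarrow> x = 0"
    and mult_linear_left: "Vector_Spaces.linear (smult L) (smult L) (\<lambda>x. x \<cdot> y)"
    and mult_linear_right: "Vector_Spaces.linear (smult L) (smult L) (\<lambda>y. x \<cdot> y)"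
    and mult_alternating: "x \<cdot> x = 0"
    and form_cyclic: "form L (x \<cdot> y) z = form L (y \<cdot> z) x"

sublocale saa \<subseteq> vector_space "smult L"
  by (rule vector_space)

definition saa_isomorphism ::
    "('f::field, 'v::ab_group_add) saa_data \<Rightarrow> ('f, 'w::ab_group_add) saa_data \<Rightarrow> ('v \<Rightarrow> 'w) \<Rightarrow> bool" where
  "saa_isomorphism L M f \<longleftrightarrow>
     Vector_Spaces.linear (smult L) (smult M) f \<and> bij f \<and>
     (\<forall>x y. f (mult L x y) = mult M (f x) (f y)) \<and>
     (\<forall>x y. form M (f x) (f y) = form L x y)"

definition saa_isomorphic ::
    "('f::field, 'v::ab_group_add) saa_data \<Rightarrow> ('f, 'w::ab_group_add) saa_data \<Rightarrow> bool" where
  "saa_isomorphic L M \<longleftrightarrow> (\<exists>f. saa_isomorphism L M f)"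

definition nonzero_powers :: "nat \<Rightarrow> 'f::field set" where
  "nonzero_powers m = {a ^ m | a. a \<noteq> 0}"

context saa
begin

definition subspace_prod :: "'v set \<Rightarrow> 'v set \<Rightarrow> 'v set" where
  "subspace_prod A B = span {a \<cdot> b | a b. a \<in> A \<and> b \<in> B}"

text \<open>\<open>lpow k\<close> is $L^k$ for \<open>k \<ge> 1\<close>; the value at \<open>0\<close> is a dummy and never used.\<close>

fun lpow :: "nat \<Rightarrow> 'v set" where
  "lpow 0 = UNIV"
| "lpow (Suc 0) = UNIV"
| "lpow (Suc (Suc k)) = subspace_prod (lpow (Suc k)) UNIV"

definition nilpotent :: bool where
  "nilpotent \<longleftrightarrow> (\<exists>k. lpow (k + 1) = {0})"

definition nilpotence_class :: nat where
  "nilpotence_class = (LEAST k. lpow (k + 1) = {0})"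

definition center :: "'v set" where
  "center = {z. \<forall>x. z \<cdot> x = 0}"

definition isotropic :: "'v set \<Rightarrow> bool" where
  "isotropic A \<longleftrightarrow> (\<forall>u\<in>A. \<forall>v\<in>A. form L u v = 0)"

definition I_ideal :: "nat \<Rightarrow> 'v set" where
  "I_ideal k = (if k = 1 then subspace_prod (lpow 5) (lpow 2)
                else if k = 2 then lpow 7
                else lpow 6)"

text \<open>
  \<open>U_index\<close> is meaningful when $L^4 L^3$ is a nonzero subspace of $L^6$, which holds for nilpotent
  algebras of dimension 10 and class 7 with isotropic center of dimension 2.
\<close>

definition U_index :: nat where
  "U_index = (LEAST k. k \<in> {1, 2, 3} \<and> I_ideal k \<inter> subspace_prod (lpow 4) (lpow 3) \<noteq> {0})"

definition U_ideal :: "'v set" where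
  "U_ideal = {x \<in> lpow 4. (\<lambda>y. x \<cdot> y) ` lpow 3 \<subseteq> I_ideal U_index}"

definition standard_basis :: "(nat \<Rightarrow> 'v) \<Rightarrow> (nat \<Rightarrow> 'v) \<Rightarrow> bool" where
  "standard_basis x y \<longleftrightarrow>
     inj_on x {1..5} \<and> inj_on y {1..5} \<and> x ` {1..5} \<inter> y ` {1..5} = {} \<and>
     independent (x ` {1..5} \<union> y ` {1..5}) \<and> span (x ` {1..5} \<union> y ` {1..5}) = UNIV \<and>
     (\<forall>i\<in>{1..5}. \<forall>j\<in>{1..5}.
        form L (x i) (x j) = 0 \<and> form L (y i) (y j) = 0 \<and>
        form L (x i) (y j) = (if i = j then 1 else 0))"

text \<open>
  A nilpotent presentation is given by the values \<open>\<alpha> i j k\<close> of $(x_i y_j, y_k)$ and \<open>\<beta> i j k\<close> of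
  $(y_i y_j, y_k)$ for $i < j < k$. Up to the alternating property, the remaining triples of basis
  vectors are the ones with at least two $x$'s and $(x_i y_j, y_k)$ with $j < k$ and $i \ge j$;
  these are the values that are 0 by convention.
\<close>

definition has_presentation ::
    "(nat \<Rightarrow> nat \<Rightarrow> nat \<Rightarrow> 'f) \<Rightarrow> (nat \<Rightarrow> nat \<Rightarrow> nat \<Rightarrow> 'f) \<Rightarrow> bool" where
  "has_presentation \<alpha> \<beta> \<longleftrightarrow>
     (\<exists>x y. standard_basis x y \<and>
        (\<forall>i\<in>{1..5}. \<forall>j\<in>{1..5}. \<forall>k\<in>{1..5}.
           (i < j \<and> j < k \<longrightarrow>
              form L (x i \<cdot> y j) (y k) = \<alpha> i j k \<and> form L (y i \<cdot> y j) (y k) = \<beta> i j k) \<and>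
           (j < k \<and> j \<le> i \<longrightarrow> form L (x i \<cdot> y j) (y k) = 0) \<and>
           form L (x i \<cdot> x j) (y k) = 0 \<and>
           form L (x i \<cdot> x j) (x k) = 0))"

definition has_presentation_P10_2_5 :: "'f \<Rightarrow> bool" where
  "has_presentation_P10_2_5 r \<longleftrightarrow>
     has_presentation
       (\<lambda>i j k. if (i, j, k) = (2, 3, 5) then r
                else if (i, j, k) = (3, 4, 5) then 1
                else if (i, j, k) = (1, 2, 5) then 1
                else 0)
       (\<lambda>i j k. if (i, j, k) = (1, 2, 3) then 1 else 0)"

definition class_7_UL2_1_dimensional :: bool where
  "class_7_UL2_1_dimensional \<longleftrightarrow>
     nilpotent \<and> dim (UNIV :: 'v set) = 10 \<and>
     isotropic center \<and> dim center = 2 \<and>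
     nilpotence_class = 7 \<and>
     subspace_prod (lpow 4) (lpow 3) \<noteq> lpow 7 \<and>
     subspace_prod (lpow 5) (lpow 2) \<subseteq> subspace_prod (lpow 4) (lpow 3) \<and>
     dim (subspace_prod U_ideal (lpow 2)) = 1"

end

end

theory Submission
  imports Defs "HOL-Analysis.Cartesian_Space"
begin

text \<open>
  The form identifies the terms $Z_j = (L^{j+1})^\perp$ of the upper central series, so that
  $Z_i L^i = 0$. Counting dimensions shows that $L, L^2, \ldots, L^7$ have dimensions
  $10, 8, 7, 6, 4, 3, 2$ and that $L^k = Z_{8-k}$ for $k \ge 4$. This gives an isotropic flag
  $L^5L^2 < Z(L) < L^6 < L^5 < U$ with a basis $x_5, \ldots, x_1$ adapted to it and to
  $L^4L^3 = \langle x_3, x_5\rangle$. A dual isotropic family $y_1, \ldots, y_5$ is then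
  automatically adapted to the flag of orthogonal complements. In such a basis only few triple
  values survive; the unwanted ones are removed by elementary symplectic transformations, and
  rescaling normalises all but one of the remaining ones. Since $L^5$, $U$, $L^4$, $L^3$, $L^2$ are
  characteristic, two normalised bases differ by a triangular transformation, and comparing the
  diagonal entries shows that the remaining value is unique up to cubes.
\<close>

section \<open>The form and orthogonal complements\<close>

text \<open>The powers of L jump from dimension 4 to 6 in the middle, so none of them is a maximal
  isotropic subspace; U supplies one of dimension 5, and this is what pins down x_1 modulo L^5 up to
  a scalar.

  A nilpotent presentation has 20 values. The conditions on L^4L^3, L^5L^2 and UL^2 make five of
  them vanish, four others are forced to be nonzero, and the remaining eleven are cleared by
  dividing by nonzero ones only. Replacing x_i by c_i x_i and y_i by y_i / c_i multiplies the four
  values (x_1y_2, y_5), (x_3y_4, y_5), (y_1y_2, y_3), (x_2y_3, y_5) by c_1/(c_2c_5), c_3/(c_4c_5),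
  1/(c_1c_2c_3), c_2/(c_3c_5). If the first three factors are 1, then c_1 = c_2c_5 and c_3 =
  1/(c_2^2 c_5), so the last factor is c_2^3: hence the cubes. No step divides by 2 or extracts a
  root, so the field is arbitrary.\<close>

context saa
begin

abbreviation scale_vec (infixr "\<odot>" 75) where "c \<odot> x \<equiv> smult L c x"

abbreviation triple :: "'v \<Rightarrow> 'v \<Rightarrow> 'v \<Rightarrow> 'f" where "triple u v w \<equiv> form L (u \<cdot> v) w"

lemma form_add_left: "form L (u + v) w = form L u w + form L v w"
  and form_scale_left: "form L (c \<odot> u) w = c * form L u w"
  and form_zero_left: "form L 0 w = 0"
  and form_minus_left: "form L (- u) w = - form L u w"
  and form_diff_left: "form L (u - v) w = form L u w - form L v w"
  and form_sum_left: "form L (sum g A) w = (\<Sum>a\<in>A. form L (g a) w)"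
proof -
  interpret f: Vector_Spaces.linear "smult L" "(*)" "\<lambda>x. form L x w" by (rule form_linear_left)
  show "form L (u + v) w = form L u w + form L v w" by (rule f.add)
  show "form L (c \<odot> u) w = c * form L u w" by (rule f.scale)
  show "form L 0 w = 0" by (rule f.zero)
  show "form L (- u) w = - form L u w" by (rule f.neg)
  show "form L (u - v) w = form L u w - form L v w" by (rule f.diff)
  show "form L (sum g A) w = (\<Sum>a\<in>A. form L (g a) w)" by (rule f.sum)
qed

lemma form_add_right: "form L w (u + v) = form L w u + form L w v"
  and form_scale_right: "form L w (c \<odot> u) = c * form L w u"
  and form_zero_right: "form L w 0 = 0"
  and form_minus_right: "form L w (- u) = - form L w u"
  and form_diff_right: "form L w (u - v) = form L w u - form L w v"
  and form_sum_right: "form L w (sum g A) = (\<Sum>a\<in>A. form L w (g a))"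
proof -
  interpret f: Vector_Spaces.linear "smult L" "(*)" "\<lambda>x. form L w x" by (rule form_linear_right)
  show "form L w (u + v) = form L w u + form L w v" by (rule f.add)
  show "form L w (c \<odot> u) = c * form L w u" by (rule f.scale)
  show "form L w 0 = 0" by (rule f.zero)
  show "form L w (- u) = - form L w u" by (rule f.neg)
  show "form L w (u - v) = form L w u - form L w v" by (rule f.diff)
  show "form L w (sum g A) = (\<Sum>a\<in>A. form L w (g a))" by (rule f.sum)
qed

lemma mult_add_left: "(u + v) \<cdot> w = u \<cdot> w + v \<cdot> w"
  and mult_scale_left: "(c \<odot> u) \<cdot> w = c \<odot> (u \<cdot> w)"
  and mult_zero_left: "0 \<cdot> w = 0"
  and mult_minus_left: "(- u) \<cdot> w = - (u \<cdot> w)"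
  and mult_diff_left: "(u - v) \<cdot> w = u \<cdot> w - v \<cdot> w"
proof -
  interpret f: Vector_Spaces.linear "smult L" "smult L" "\<lambda>x. x \<cdot> w" by (rule mult_linear_left)
  show "(u + v) \<cdot> w = u \<cdot> w + v \<cdot> w" by (rule f.add)
  show "(c \<odot> u) \<cdot> w = c \<odot> (u \<cdot> w)" by (rule f.scale)
  show "0 \<cdot> w = 0" by (rule f.zero)
  show "(- u) \<cdot> w = - (u \<cdot> w)" by (rule f.neg)
  show "(u - v) \<cdot> w = u \<cdot> w - v \<cdot> w" by (rule f.diff)
qed

lemma mult_add_right: "w \<cdot> (u + v) = w \<cdot> u + w \<cdot> v"
  and mult_scale_right: "w \<cdot> (c \<odot> u) = c \<odot> (w \<cdot> u)"
  and mult_zero_right: "w \<cdot> 0 = 0"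
  and mult_minus_right: "w \<cdot> (- u) = - (w \<cdot> u)"
  and mult_diff_right: "w \<cdot> (u - v) = w \<cdot> u - w \<cdot> v"
proof -
  interpret f: Vector_Spaces.linear "smult L" "smult L" "\<lambda>x. w \<cdot> x" by (rule mult_linear_right)
  show "w \<cdot> (u + v) = w \<cdot> u + w \<cdot> v" by (rule f.add)
  show "w \<cdot> (c \<odot> u) = c \<odot> (w \<cdot> u)" by (rule f.scale)
  show "w \<cdot> 0 = 0" by (rule f.zero)
  show "w \<cdot> (- u) = - (w \<cdot> u)" by (rule f.neg)
  show "w \<cdot> (u - v) = w \<cdot> u - w \<cdot> v" by (rule f.diff)
qed

lemmas form_simps =
  form_add_left form_scale_left form_zero_left form_minus_left form_diff_left
  form_add_right form_scale_right form_zero_right form_minus_right form_diff_right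

lemmas mult_simps =
  mult_add_left mult_scale_left mult_zero_left mult_minus_left mult_diff_left
  mult_add_right mult_scale_right mult_zero_right mult_minus_right mult_diff_right

lemma form_skew: "form L x y = - form L y x"
proof -
  have "form L (x + y) (x + y) = 0" by (rule form_alternating)
  hence "form L y x + form L x y = 0"
    by (simp add: form_add_left form_add_right form_alternating[of x] form_alternating[of y])
  thus ?thesis by (simp add: eq_neg_iff_add_eq_0 add.commute)
qed

lemma mult_skew: "x \<cdot> y = - (y \<cdot> x)"
proof -
  have "(x + y) \<cdot> (x + y) = 0" by (rule mult_alternating)
  hence "y \<cdot> x + x \<cdot> y = 0"
    by (simp add: mult_add_left mult_add_right mult_alternating[of x] mult_alternating[of y])
  thus ?thesis by (simp add: eq_neg_iff_add_eq_0 add.commute)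
qed

lemma triple_cyclic: "triple u v w = triple v w u"
  by (rule form_cyclic)

lemma triple_swap12: "triple u v w = - triple v u w"
  by (subst mult_skew) (simp add: form_minus_left)

lemma triple_swap23: "triple u v w = - triple u w v"
  using triple_swap12[of v w u] triple_cyclic[of u v w] triple_cyclic[of w v u] triple_cyclic[of v u w]
  by simp

lemma triple_same12: "triple u u w = 0"
  by (simp add: mult_alternating form_zero_left)

lemma triple_same13: "triple u w u = 0"
  using triple_cyclic[of u w u] triple_cyclic[of w u u] triple_same12[of u w] by simp

lemma triple_same23: "triple w u u = 0"
  using triple_cyclic[of w u u] triple_same12[of u w] by simp

lemmas triple_same = triple_same12 triple_same13 triple_same23

lemma form_nondegenerate_right: "(\<And>y. form L y x = 0) \<Longrightarrow> x = 0"
  using form_nondegenerate[of x] form_skew[of x] by simp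

definition perp :: "'v set \<Rightarrow> 'v set" where
  "perp A = {x. \<forall>a\<in>A. form L a x = 0}"

lemma perpI: "(\<And>a. a \<in> A \<Longrightarrow> form L a x = 0) \<Longrightarrow> x \<in> perp A"
  by (simp add: perp_def)

lemma perpD: "x \<in> perp A \<Longrightarrow> a \<in> A \<Longrightarrow> form L a x = 0"
  by (simp add: perp_def)

lemma perpD': "x \<in> perp A \<Longrightarrow> a \<in> A \<Longrightarrow> form L x a = 0"
  using perpD[of x A a] form_skew[of x a] by simp

lemma perp_anti: "A \<subseteq> B \<Longrightarrow> perp B \<subseteq> perp A"
  by (auto simp: perp_def)

lemma subspace_perp: "subspace (perp A)"
  by (rule subspaceI) (auto simp: perp_def form_simps)

lemma perp_span: "perp (span A) = perp A"
proof
  show "perp (span A) \<subseteq> perp A" by (intro perp_anti span_superset)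
  show "perp A \<subseteq> perp (span A)"
  proof
    fix x assume x: "x \<in> perp A"
    have "subspace {a. form L a x = 0}"
      by (rule subspaceI) (auto simp: form_simps)
    moreover have "A \<subseteq> {a. form L a x = 0}" using x by (auto simp: perp_def)
    ultimately have "span A \<subseteq> {a. form L a x = 0}" by (intro span_minimal)
    thus "x \<in> perp (span A)" by (auto simp: perp_def)
  qed
qed

lemma perp_UNIV: "perp UNIV = {0}"
  using form_nondegenerate_right by (auto simp: perp_def form_simps)

lemma subset_perp_perp: "A \<subseteq> perp (perp A)"
  using perpD' by (auto intro!: perpI)

text \<open>Induction, dualising one vector at a time. Removing from \<open>b\<close> its components
  along \<open>B\<close> leaves a vector \<open>b'\<close> orthogonal to all old dual vectors;
  independence makes it nonzero, and non-degeneracy provides a partner \<open>z\<close>.\<close>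

lemma dual_family:
  assumes "finite B" "independent B"
  shows "\<exists>w. \<forall>b\<in>B. \<forall>c\<in>B. form L b (w c) = (if b = c then 1 else 0)"
  using assms
proof (induction B)
  case empty
  thus ?case by simp
next
  case (insert b B)
  hence "independent B" "b \<notin> span B"
    by (auto simp: independent_insert)
  with insert obtain w where w: "\<And>b c. b \<in> B \<Longrightarrow> c \<in> B \<Longrightarrow> form L b (w c) = (if b = c then 1 else 0)"
    by blast
  define b' where "b' = b - (\<Sum>c\<in>B. form L b (w c) \<odot> c)"
  have "(\<Sum>c\<in>B. form L b (w c) \<odot> c) \<in> span B"
    by (intro span_sum span_scale span_base)
  hence "b' \<noteq> 0" using \<open>b \<notin> span B\<close> by (auto simp: b'_def)
  then obtain z where z: "form L b' z \<noteq> 0" using form_nondegenerate by blast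
  define z' where "z' = z - (\<Sum>c\<in>B. form L c z \<odot> w c)"
  have bz: "form L b z' = form L b' z"
    unfolding z'_def b'_def
    by (simp add: form_simps form_sum_left form_sum_right mult.commute)
  have cz: "form L c z' = 0" if c: "c \<in> B" for c
  proof -
    have "(\<Sum>d\<in>B. form L d z * form L c (w d)) = (\<Sum>d\<in>B. if c = d then form L d z else 0)"
      by (rule sum.cong) (auto simp: w c)
    thus ?thesis using c insert(1) by (simp add: z'_def form_simps form_sum_right sum.delta)
  qed
  define e where "e = inverse (form L b' z) \<odot> z'"
  have e: "form L b e = 1" "\<And>c. c \<in> B \<Longrightarrow> form L c e = 0"
    using z by (auto simp: e_def form_simps bz cz)
  \<comment> \<open>The old dual vectors become orthogonal to \<open>b\<close> by subtracting
    multiples of \<open>e\<close>; their pairings with \<open>B\<close> survive because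
    \<open>e\<close> is orthogonal to \<open>B\<close>.\<close>
  define w' where "w' = (\<lambda>c. if c = b then e else w c - form L b (w c) \<odot> e)"
  have "\<forall>p\<in>insert b B. \<forall>c\<in>insert b B. form L p (w' c) = (if p = c then 1 else 0)"
    using insert(2) w e by (auto simp: w'_def form_simps)
  thus ?case by blast
qed

text \<open>A vector \<open>u\<close> outside \<open>A\<close> extends a basis of \<open>A\<close>
  to an independent family, and the dual vector of \<open>u\<close> is orthogonal to
  \<open>A\<close> but not to \<open>u\<close>.\<close>

lemma perp_perp:
  assumes "subspace A"
  shows "perp (perp A) = A"
proof
  show "A \<subseteq> perp (perp A)" by (rule subset_perp_perp)
  show "perp (perp A) \<subseteq> A"
  proof
    fix u assume u: "u \<in> perp (perp A)"
    obtain B where B: "B \<subseteq> A" "independent B" "A \<subseteq> span B" "card B = dim A" by (rule basis_exists)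
    have sB: "span B = A" using B(1,3) assms by (rule span_subspace)
    show "u \<in> A"
    proof (rule ccontr)
      assume "u \<notin> A"
      hence ind: "independent (insert u B)" using B sB by (simp add: independent_insert)
      obtain B0 where "finite B0" "span B0 = UNIV" using finite_dimensional by blast
      hence "finite (insert u B)" using independent_span_bound[OF _ ind, of B0] by simp
      from dual_family[OF this ind] obtain w where
        w: "\<And>b c. b \<in> insert u B \<Longrightarrow> c \<in> insert u B \<Longrightarrow> form L b (w c) = (if b = c then 1 else 0)"
        by blast
      have "w u \<in> perp B" using w \<open>u \<notin> A\<close> B(1) by (auto intro!: perpI)
      hence "w u \<in> perp A" using perp_span[of B] sB by simp
      hence "form L u (w u) = 0" using u perpD'[of u "perp A" "w u"] by simp
      thus False using w[of u u] by simp
    qed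
  qed
qed

end

text \<open>The locale \<open>finite_dimensional_vector_space\<close> takes a concrete basis as
  parameter; a chosen one is named so that \<open>saa\<close> becomes a sublocale of it.\<close>

definition (in saa) some_basis :: "'v set" where
  "some_basis = (SOME B. finite B \<and> independent B \<and> span B = UNIV)"

sublocale saa \<subseteq> fd: finite_dimensional_vector_space "smult L" some_basis
proof -
  obtain B0 where B0: "finite B0" "span B0 = UNIV" using finite_dimensional by blast
  obtain B where B: "B \<subseteq> B0" "independent B" "B0 \<subseteq> span B"
    by (rule maximal_independent_subset)
  have "span B = UNIV" using B(3) B0(2) span_minimal[OF B(3)] by auto
  hence "\<exists>B. finite B \<and> independent B \<and> span B = UNIV" using B(1,2) B0(1) by (blast dest: finite_subset)
  hence "finite some_basis \<and> independent some_basis \<and> span some_basis = UNIV"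
    unfolding some_basis_def by (rule someI_ex)
  thus "finite_dimensional_vector_space (smult L) some_basis"
    by unfold_locales auto
qed

context saa
begin

text \<open>As a rewrite rule it would replace the dimension of the whole space by the size of the
  arbitrary \<open>some_basis\<close>.\<close>

declare fd.dim_UNIV [simp del]

text \<open>Dual vectors of a basis \<open>B\<close> of \<open>A\<close> together with a basis
  \<open>C\<close> of the complement form a basis of the whole space: subtracting from
  \<open>v\<close> the dual vectors with coefficients (b, v) lands in the complement.\<close>

lemma dim_perp:
  assumes "subspace A"
  shows "dim A + dim (perp A) = dim (UNIV :: 'v set)"
proof -
  obtain B where B: "B \<subseteq> A" "independent B" "A \<subseteq> span B" "card B = dim A"
    by (rule basis_exists)
  have sB: "span B = A" using B(1,3) assms by (rule span_subspace)
  have fin: "finite B" using B(2) by (rule fd.finiteI_independent)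
  obtain w where w: "\<And>b c. b \<in> B \<Longrightarrow> c \<in> B \<Longrightarrow> form L b (w c) = (if b = c then 1 else 0)"
    using dual_family[OF fin B(2)] by (elim exE) blast
  obtain C where C: "C \<subseteq> perp A" "independent C" "perp A \<subseteq> span C" "card C = dim (perp A)"
    by (rule basis_exists)
  have sC: "span C = perp A" using C(1,3) subspace_perp by (rule span_subspace)
  have finC: "finite C" using C(2) by (rule fd.finiteI_independent)
  have perpA: "perp A = perp B" using perp_span[of B] sB by simp
  have dec: "v - (\<Sum>b\<in>B. form L b v \<odot> w b) \<in> perp A" for v
    unfolding perpA
  proof (rule perpI)
    fix c assume c: "c \<in> B"
    have "(\<Sum>d\<in>B. form L d v * form L c (w d)) = (\<Sum>d\<in>B. if c = d then form L d v else 0)"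
      by (rule sum.cong) (auto simp: w c)
    thus "form L c (v - (\<Sum>b\<in>B. form L b v \<odot> w b)) = 0"
      using c fin by (simp add: form_simps form_sum_right sum.delta)
  qed
  have winj: "inj_on w B"
  proof (rule inj_onI)
    fix b c assume "b \<in> B" "c \<in> B" "w b = w c"
    thus "b = c" using w[of b b] w[of b c] by (auto split: if_splits)
  qed
  have sp: "span (w ` B \<union> C) = UNIV"
  proof -
    have "v \<in> span (w ` B \<union> C)" for v
    proof -
      have "v - (\<Sum>b\<in>B. form L b v \<odot> w b) \<in> span (w ` B \<union> C)"
        using dec[of v] sC span_mono[of C "w ` B \<union> C"] by auto
      moreover have "(\<Sum>b\<in>B. form L b v \<odot> w b) \<in> span (w ` B \<union> C)"
        by (intro span_sum span_scale span_base) auto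
      ultimately have "v - (\<Sum>b\<in>B. form L b v \<odot> w b) + (\<Sum>b\<in>B. form L b v \<odot> w b) \<in> span (w ` B \<union> C)"
        by (rule span_add)
      thus ?thesis by simp
    qed
    thus ?thesis by auto
  qed
  have disj: "w ` B \<inter> C = {}"
  proof -
    have "w b \<notin> perp B" if "b \<in> B" for b
      using perpD[of "w b" B b] w[of b b] that by auto
    thus ?thesis using C(1) perpA by auto
  qed
  have "independent (w ` B \<union> C)"
  proof (rule independent_if_scalars_zero)
    show "finite (w ` B \<union> C)" using fin finC by simp
    fix g x assume s: "(\<Sum>x\<in>w ` B \<union> C. g x \<odot> x) = 0" and x: "x \<in> w ` B \<union> C"
    have split: "(\<Sum>b\<in>B. g (w b) \<odot> w b) + (\<Sum>c\<in>C. g c \<odot> c) = 0"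
      using s disj fin finC winj by (simp add: sum.union_disjoint sum.reindex)
    have gB: "g (w b) = 0" if b: "b \<in> B" for b
    proof -
      have "form L b ((\<Sum>b\<in>B. g (w b) \<odot> w b) + (\<Sum>c\<in>C. g c \<odot> c)) = 0"
        using split by (simp add: form_simps)
      moreover have "(\<Sum>c\<in>C. g c * form L b c) = 0"
        by (rule sum.neutral) (use C(1) perpA b perpD in auto)
      moreover have "(\<Sum>d\<in>B. g (w d) * form L b (w d)) = (\<Sum>d\<in>B. if b = d then g (w d) else 0)"
        by (rule sum.cong) (auto simp: w b)
      ultimately show ?thesis using b fin by (simp add: form_simps form_sum_right sum.delta)
    qed
    hence "(\<Sum>c\<in>C. g c \<odot> c) = 0" using split by simp
    hence "g c = 0" if "c \<in> C" for c
      using C(2) finC that by (auto simp: fd.independent_explicit)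
    thus "g x = 0" using x gB by auto
  qed
  hence "dim (UNIV :: 'v set) = card (w ` B \<union> C)"
    using dim_span_eq_card_independent sp by metis
  also have "\<dots> = card B + card C"
    using disj fin finC winj by (simp add: card_Un_disjoint card_image)
  finally show ?thesis using B(4) C(4) by simp
qed

end

section \<open>Central series\<close>

context saa
begin

lemma subspace_psubset_dim:
  assumes "subspace A" "subspace B" "A \<subseteq> B" "A \<noteq> B"
  shows "dim A < dim B"
proof -
  have "dim A \<le> dim B" using assms(3) by (rule fd.dim_subset)
  moreover have "dim A \<noteq> dim B"
    using fd.subspace_dim_equal[OF assms(1,2,3)] assms(4) by auto
  ultimately show ?thesis by simp
qed

lemma dim_le_insert:
  assumes "A \<subseteq> span (insert c B)"
  shows "dim A \<le> dim B + 1"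
  using fd.dim_mono[OF assms] by (simp add: fd.dim_insert split: if_splits)

lemma span_of_subspace: "subspace A \<Longrightarrow> span A = A"
  by (simp only: span_eq_iff)

lemma span_insert_eq:
  assumes "subspace A" "subspace B" "A \<subseteq> B" "dim B = dim A + 1" "x \<in> B" "x \<notin> A"
  shows "B = span (insert x A)"
proof -
  have "span (insert x A) \<subseteq> B" using assms by (intro span_minimal) auto
  moreover have "dim (span (insert x A)) = dim B"
    using assms by (simp add: fd.dim_insert span_of_subspace)
  ultimately show ?thesis using fd.subspace_dim_equal assms(2) by (metis order_refl subspace_span)
qed

lemma in_span_insertE:
  assumes "x \<in> span (insert a S)" "subspace S"
  obtains k s where "s \<in> S" "x = k \<odot> a + s"
proof -
  obtain k where "x - k \<odot> a \<in> S"
    using assms by (auto simp: span_breakdown_eq span_of_subspace)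
  thus thesis using that[of "x - k \<odot> a" k] by simp
qed

lemma span_insert_span: "span (insert x (span S)) = span (insert x S)"
  by (simp add: span_insert span_of_subspace)

lemma span_insertI: "s \<in> span S \<Longrightarrow> k \<odot> a + s \<in> span (insert a S)"
  by (auto simp: span_breakdown_eq intro!: exI[of _ k])

lemma mult_in_subspace_prod: "a \<in> A \<Longrightarrow> b \<in> B \<Longrightarrow> a \<cdot> b \<in> subspace_prod A B"
  unfolding subspace_prod_def by (intro span_base) blast

lemma subspace_subspace_prod: "subspace (subspace_prod A B)"
  unfolding subspace_prod_def by (rule subspace_span)

lemma subspace_prod_subset:
  assumes "subspace C" "\<And>a b. a \<in> A \<Longrightarrow> b \<in> B \<Longrightarrow> a \<cdot> b \<in> C"
  shows "subspace_prod A B \<subseteq> C"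
  unfolding subspace_prod_def by (rule span_minimal) (use assms in auto)

lemma lpow_Suc: "n \<ge> 1 \<Longrightarrow> lpow (Suc n) = subspace_prod (lpow n) UNIV"
  by (cases n) auto

lemma lpow_one: "lpow 1 = UNIV"
  by simp

lemma subspace_lpow: "subspace (lpow n)"
  by (induction n rule: lpow.induct) (auto simp: subspace_subspace_prod)

lemma mult_lpow: "n \<ge> 1 \<Longrightarrow> a \<in> lpow n \<Longrightarrow> a \<cdot> b \<in> lpow (Suc n)"
  by (simp add: lpow_Suc mult_in_subspace_prod)

lemma mult_lpow': "n \<ge> 1 \<Longrightarrow> a \<in> lpow n \<Longrightarrow> b \<cdot> a \<in> lpow (Suc n)"
  using mult_lpow[of n a b] mult_skew[of b a] subspace_neg[OF subspace_lpow] by simp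

lemma lpow_Suc_subset: "lpow (Suc n) \<subseteq> lpow n"
proof (induction n rule: lpow.induct)
  case (3 k)
  have "subspace_prod (lpow (Suc (Suc k))) UNIV \<subseteq> subspace_prod (lpow (Suc k)) UNIV"
    using 3 unfolding subspace_prod_def by (intro span_mono) (auto simp del: lpow.simps)
  thus ?case by simp
qed auto

lemma lpow_antimono: "m \<le> n \<Longrightarrow> lpow n \<subseteq> lpow m"
  by (rule lift_Suc_antimono_le[of lpow]) (rule lpow_Suc_subset)

lemma lpow_stable:
  assumes "lpow (Suc n) = lpow n" "n \<ge> 1"
  shows "lpow (n + k) = lpow n"
proof (induction k)
  case (Suc k)
  have "lpow (n + Suc k) = subspace_prod (lpow (n + k)) UNIV" using assms(2) by (simp add: lpow_Suc)
  also have "\<dots> = lpow (Suc n)" using Suc assms(2) by (simp add: lpow_Suc)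
  finally show ?case using assms by simp
qed simp

text \<open>The upper central series, defined through the form so that its dimensions follow from
  those of the powers; its usual recursion is \<open>ucs_Suc\<close>.\<close>

definition ucs :: "nat \<Rightarrow> 'v set" where
  "ucs j = perp (lpow (Suc j))"

lemma subspace_ucs: "subspace (ucs j)"
  by (simp add: ucs_def subspace_perp)

lemma perp_ucs: "perp (ucs j) = lpow (Suc j)"
  by (simp add: ucs_def perp_perp subspace_lpow)

lemma ucs_0: "ucs 0 = {0}"
  by (simp add: ucs_def perp_UNIV)

text \<open>Cyclicity gives (ab, x) = (a, xb). Hence x is orthogonal to L^{j+1}L exactly when xL is
  orthogonal to L^{j+1}.\<close>

lemma ucs_Suc: "x \<in> ucs (Suc j) \<longleftrightarrow> (\<forall>y. x \<cdot> y \<in> ucs j)"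
proof -
  have t: "triple a b x = form L a (x \<cdot> b)" for a b
    using triple_cyclic[of a b x] triple_swap12[of b x a] form_skew[of a "x \<cdot> b"] by simp
  have "x \<in> ucs (Suc j) \<longleftrightarrow> (\<forall>a\<in>lpow (Suc j). \<forall>b. triple a b x = 0)"
    by (auto simp: ucs_def subspace_prod_def perp_span) (auto simp: perp_def)
  also have "\<dots> \<longleftrightarrow> (\<forall>y. x \<cdot> y \<in> ucs j)"
    unfolding t by (auto simp: ucs_def perp_def)
  finally show ?thesis .
qed

lemma ucs_1: "ucs 1 = center"
  by (auto simp: ucs_Suc ucs_0 center_def)

text \<open>For every z one has (xy, z) = -(xz, y), and xz lies one step lower in the series, where
  everything is orthogonal to L^i.\<close>

lemma mult_ucs_lpow:
  assumes "x \<in> ucs i" "y \<in> lpow i"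
  shows "x \<cdot> y = 0"
proof (cases i)
  case 0
  thus ?thesis using assms by (simp add: ucs_0 mult_zero_left)
next
  case (Suc j)
  show ?thesis
  proof (rule form_nondegenerate)
    fix z
    have "x \<cdot> z \<in> ucs j" using assms Suc by (simp add: ucs_Suc)
    hence "form L (x \<cdot> z) y = 0" using assms(2) Suc by (auto simp: ucs_def dest: perpD')
    thus "triple x y z = 0" using triple_swap23[of x y z] by simp
  qed
qed

lemma lpow_subset_ucs:
  assumes "lpow m = {0}" "k < m"
  shows "lpow (m - k) \<subseteq> ucs k"
  using assms(2)
proof (induction k)
  case 0
  thus ?case using assms(1) by (simp add: ucs_0)
next
  case (Suc k)
  show ?case
  proof
    fix x assume x: "x \<in> lpow (m - Suc k)"
    have "x \<cdot> y \<in> lpow (m - k)" for y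
      using mult_lpow[of "m - Suc k" x y] x Suc.prems by (simp add: Suc_diff_Suc)
    thus "x \<in> ucs (Suc k)" using Suc by (auto simp: ucs_Suc)
  qed
qed

text \<open>Replaces the minimum by two equations on powers. The bound on \<open>c\<close> keeps the
  dummy \<open>lpow 0\<close> out of the right-hand side.\<close>

lemma nilpotence_class_iff:
  assumes "c \<ge> 1"
  shows "nilpotent \<and> nilpotence_class = c \<longleftrightarrow> lpow (Suc c) = {0} \<and> lpow c \<noteq> {0}"
proof (safe del: equalityI)
  assume n: "nilpotent" "c = nilpotence_class"
  obtain k where k: "lpow (k + 1) = {0}" using n by (auto simp: nilpotent_def)
  show "lpow (Suc nilpotence_class) = {0}"
    using LeastI[of "\<lambda>k. lpow (k + 1) = {0}", OF k] by (simp add: nilpotence_class_def)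
  assume "lpow nilpotence_class = {0}"
  hence "nilpotence_class \<le> nilpotence_class - 1"
    using assms n(2) unfolding nilpotence_class_def by (intro Least_le) simp
  thus False using assms n(2) by simp
next
  assume l: "lpow (Suc c) = {0}" "lpow c \<noteq> {0}"
  show "nilpotent" using l(1) by (auto simp: nilpotent_def)
  show "nilpotence_class = c"
    unfolding nilpotence_class_def
  proof (rule Least_equality)
    show "lpow (c + 1) = {0}" using l by simp
    fix k assume k: "lpow (k + 1) = {0}"
    show "c \<le> k"
    proof (rule ccontr)
      assume "\<not> c \<le> k"
      hence "lpow c \<subseteq> {0}" using lpow_antimono[of "k + 1" c] k by simp
      thus False using l(2) subspace_0[OF subspace_lpow[of c]] by auto
    qed
  qed
qed

end

section \<open>Dimensions of the powers in class 7\<close>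

locale saa_class_7 = saa L
  for L :: "('f::field, 'v::ab_group_add) saa_data" (structure) +
  assumes dim_UNIV_10: "dim (UNIV :: 'v set) = 10"
    and dim_center_2: "dim center = 2"
    and lpow_8: "lpow 8 = {0}"
    and lpow_7_nonzero: "lpow 7 \<noteq> {0}"
begin

lemma lpow_psubset:
  assumes "1 \<le> k" "k \<le> 7"
  shows "lpow (Suc k) \<noteq> lpow k"
proof
  assume "lpow (Suc k) = lpow k"
  from lpow_stable[OF this assms(1)] have *: "lpow (k + n) = lpow k" for n .
  show False using *[of "8 - k"] *[of "7 - k"] assms lpow_8 lpow_7_nonzero by simp
qed

lemma dim_lpow_less: "1 \<le> k \<Longrightarrow> k \<le> 7 \<Longrightarrow> dim (lpow (Suc k)) < dim (lpow k)"
  using lpow_psubset by (intro subspace_psubset_dim subspace_lpow lpow_Suc_subset) auto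

lemma dim_ucs: "dim (ucs j) + dim (lpow (Suc j)) = 10"
  using dim_perp[OF subspace_lpow[of "Suc j"]] dim_UNIV_10 by (simp add: ucs_def)

lemma lpow_ucs: "1 \<le> k \<Longrightarrow> k \<le> 8 \<Longrightarrow> lpow k \<subseteq> ucs (8 - k)"
  using lpow_subset_ucs[OF lpow_8, of "8 - k"] by simp

lemma dim_lpow_2: "dim (lpow 2) = 8"
  using dim_ucs[of 1] dim_center_2 by (simp add: ucs_1[simplified] numeral_2_eq_2)

text \<open>L^2 is the orthogonal complement of the center, so dual vectors of a basis of the center
  span a complement of L^2, and their pairings determine a central element.\<close>

lemma generators_ex:
  obtains a b where "\<And>v. \<exists>s t. \<exists>w\<in>lpow 2. v = s \<odot> a + t \<odot> b + w"
    and "\<And>z. z \<in> center \<Longrightarrow> form L z a = 0 \<Longrightarrow> form L z b = 0 \<Longrightarrow> z = 0"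
proof -
  obtain B where B: "B \<subseteq> center" "independent B" "center \<subseteq> span B" "card B = dim center"
    by (rule basis_exists)
  obtain z1 z2 where z: "B = {z1, z2}" "z1 \<noteq> z2"
    using B(4) dim_center_2 by (auto simp: card_2_iff)
  obtain w where w: "\<And>b c. b \<in> B \<Longrightarrow> c \<in> B \<Longrightarrow> form L b (w c) = (if b = c then 1 else 0)"
    using dual_family[OF fd.finiteI_independent[OF B(2)] B(2)] by (elim exE) blast
  have sc: "subspace center" using subspace_ucs[of 1] by (simp add: ucs_1[simplified])
  have sB: "span B = center" using B(1,3) sc by (rule span_subspace)
  have pc: "perp B = lpow 2"
    using perp_ucs[of 1] perp_span[of B] sB by (simp add: ucs_1[simplified] numeral_2_eq_2)
  have 1: "\<exists>s t. \<exists>u\<in>lpow 2. v = s \<odot> w z1 + t \<odot> w z2 + u" for v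
  proof -
    define u where "u = v - form L z1 v \<odot> w z1 - form L z2 v \<odot> w z2"
    have "u \<in> lpow 2" unfolding pc[symmetric]
      using w z by (intro perpI) (auto simp: u_def form_simps)
    moreover have "v = form L z1 v \<odot> w z1 + form L z2 v \<odot> w z2 + u" by (simp add: u_def)
    ultimately show ?thesis by blast
  qed
  have 2: "x = 0" if "x \<in> center" "form L x (w z1) = 0" "form L x (w z2) = 0" for x
  proof -
    have "x \<in> span B" using that B by auto
    then obtain k l where x: "x = k \<odot> z1 + l \<odot> z2"
      unfolding z(1) by (auto simp: span_breakdown_eq algebra_simps)
    thus ?thesis using that(2,3) w z by (auto simp: form_simps)
  qed
  show thesis using 1 2 by (rule that)
qed

text \<open>With two generators modulo L^2, the quotient L^2/L^3 is spanned by ab, and L^3/L^4 by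
  (ab)a and (ab)b. This limits how fast the dimension drops; strict descent then fixes it for L^3,
  while 5 and 6 stay possible for L^4.\<close>

lemma dim_lpow_3: "dim (lpow 3) = 7"
  and dim_lpow_4_ge: "dim (lpow 4) \<ge> 5"
proof -
  obtain a b where ab: "\<And>v. \<exists>s t. \<exists>w\<in>lpow 2. v = s \<odot> a + t \<odot> b + w"
    by (rule generators_ex) blast
  define c where "c = a \<cdot> b"
  have l23: "u \<cdot> v \<in> lpow 3" "v \<cdot> u \<in> lpow 3" if "u \<in> lpow 2" for u v
    using that mult_lpow[of 2 u v] mult_lpow'[of 2 u v] by (simp_all del: lpow.simps)
  have l34: "u \<cdot> v \<in> lpow 4" "v \<cdot> u \<in> lpow 4" if "u \<in> lpow 3" for u v
    using that mult_lpow[of 3 u v] mult_lpow'[of 3 u v] by (simp_all del: lpow.simps)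
  note [simp del] = lpow.simps
  have L2: "lpow 2 \<subseteq> span (insert c (lpow 3))"
  proof -
    have "x \<cdot> y \<in> span (insert c (lpow 3))" for x y
    proof -
      obtain s t w where x: "x = s \<odot> a + t \<odot> b + w" "w \<in> lpow 2" using ab by blast
      obtain s' t' w' where y: "y = s' \<odot> a + t' \<odot> b + w'" "w' \<in> lpow 2" using ab by blast
      have "x \<cdot> y = (s * t' - t * s') \<odot> c + ((s \<odot> a + t \<odot> b) \<cdot> w' + w \<cdot> y)"
        using mult_skew[of b a]
        by (simp add: x y c_def mult_simps mult_alternating algebra_simps scale_left_diff_distrib)
      moreover have "(s \<odot> a + t \<odot> b) \<cdot> w' + w \<cdot> y \<in> lpow 3"
        using l23 x y by (intro subspace_add subspace_lpow) auto
      ultimately show ?thesis by (simp only: span_insertI span_base)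
    qed
    hence "subspace_prod (lpow 1) UNIV \<subseteq> span (insert c (lpow 3))"
      by (intro subspace_prod_subset) auto
    thus ?thesis using lpow_Suc[of 1] by (simp add: numeral_2_eq_2)
  qed
  have "8 \<le> dim (lpow 3) + 1" using dim_le_insert[OF L2] dim_lpow_2 by simp
  moreover have "dim (lpow 3) < 8" using dim_lpow_less[of 2] dim_lpow_2 by simp
  ultimately show d3: "dim (lpow 3) = 7" by simp
  have dec: "\<exists>k. \<exists>x'\<in>lpow 3. u = k \<odot> c + x'" if "u \<in> lpow 2" for u
  proof -
    have "u \<in> span (insert c (lpow 3))" using that L2 by auto
    then obtain x' k where "x' \<in> lpow 3" "u = k \<odot> c + x'"
      using subspace_lpow by (rule in_span_insertE)
    thus ?thesis by blast
  qed
  have "lpow 3 \<subseteq> span (insert (c \<cdot> a) (insert (c \<cdot> b) (lpow 4)))"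
  proof -
    have "x \<cdot> y \<in> span (insert (c \<cdot> a) (insert (c \<cdot> b) (lpow 4)))" if x2: "x \<in> lpow 2" for x y
    proof -
      obtain k x' where x: "x' \<in> lpow 3" "x = k \<odot> c + x'"
        using dec[OF x2] by blast
      obtain s t w where y: "y = s \<odot> a + t \<odot> b + w" "w \<in> lpow 2" using ab by blast
      obtain l w' where w: "w' \<in> lpow 3" "w = l \<odot> c + w'"
        using dec[OF y(2)] by blast
      have "x \<cdot> y = (k * s) \<odot> (c \<cdot> a) + ((k * t) \<odot> (c \<cdot> b) + (k \<odot> (c \<cdot> w') + x' \<cdot> y))"
        by (simp add: x y(1) w(2) mult_simps mult_alternating algebra_simps)
      moreover have "k \<odot> (c \<cdot> w') + x' \<cdot> y \<in> lpow 4"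
        using l34 x w by (intro subspace_add subspace_lpow subspace_scale) auto
      ultimately show ?thesis by (simp only: span_insertI span_base)
    qed
    hence "subspace_prod (lpow 2) UNIV \<subseteq> span (insert (c \<cdot> a) (insert (c \<cdot> b) (lpow 4)))"
      by (intro subspace_prod_subset) auto
    thus ?thesis using lpow_Suc[of 2] by (simp add: numeral_3_eq_3 numeral_2_eq_2)
  qed
  from dim_le_insert[OF this] have "7 \<le> dim (insert (c \<cdot> b) (lpow 4)) + 1" using d3 by simp
  moreover have "dim (insert (c \<cdot> b) (lpow 4)) \<le> dim (lpow 4) + 1"
    by (rule dim_le_insert) (rule span_superset)
  ultimately show "dim (lpow 4) \<ge> 5" by simp
qed

text \<open>Elements of Z_2 annihilate L^2, so \<open>u\<close> acts through \<open>a\<close> and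
  \<open>b\<close> alone. If (ua, b) were 0, the central elements ua and ub would be orthogonal to
  both generators and vanish. As it is nonzero, ua and ub together fill the center.\<close>

lemma center_subset_mult:
  assumes "u \<in> ucs 2" "u \<notin> center"
  shows "center \<subseteq> span (range (\<lambda>v. u \<cdot> v))"
proof -
  obtain a b where ab: "\<And>v. \<exists>s t. \<exists>w\<in>lpow 2. v = s \<odot> a + t \<odot> b + w"
    and nz: "\<And>z. z \<in> center \<Longrightarrow> form L z a = 0 \<Longrightarrow> form L z b = 0 \<Longrightarrow> z = 0"
    by (rule generators_ex) blast
  have uc: "u \<cdot> v \<in> center" for v
    using assms(1) ucs_Suc[of u 1] ucs_1 by (simp add: numeral_2_eq_2)
  have t0: "triple u a b \<noteq> 0"
  proof
    assume t: "triple u a b = 0"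
    have "u \<cdot> a = 0" using t by (intro nz uc) (auto simp: triple_same)
    moreover have "u \<cdot> b = 0"
      using t triple_swap23[of u a b] by (intro nz uc) (auto simp: triple_same)
    moreover have "u \<cdot> w = 0" if "w \<in> lpow 2" for w
      using assms(1) that by (rule mult_ucs_lpow)
    ultimately have "u \<cdot> v = 0" for v
      using ab[of v] by (auto simp: mult_simps)
    thus False using assms(2) by (simp add: center_def)
  qed
  show ?thesis
  proof
    fix z assume z: "z \<in> center"
    \<comment> \<open>The combination of ua and ub that has the same pairings with \<open>a\<close>
      and \<open>b\<close> as \<open>z\<close>.\<close>
    define q where "q = (form L z b / triple u a b) \<odot> (u \<cdot> a) + (form L z a / triple u b a) \<odot> (u \<cdot> b)"
    have t1: "triple u b a \<noteq> 0" using t0 triple_swap23[of u a b] by auto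
    have sc: "subspace center" using subspace_ucs[of 1] by (simp add: ucs_1[simplified])
    have "z - q = 0"
      using t0 t1 sc z uc
      by (intro nz) (auto simp: q_def form_simps triple_same intro!: subspace_diff subspace_add subspace_scale)
    moreover have "q \<in> span (range (\<lambda>v. u \<cdot> v))"
      unfolding q_def by (intro span_add span_scale span_base) auto
    ultimately show "z \<in> span (range (\<lambda>v. u \<cdot> v))" by simp
  qed
qed

text \<open>Since L^7 is nonzero, some u in L^6 is not central; then L^7 contains uL and with it the
  center. So L^6 has dimension more than 2, and it lies in Z_2, which has dimension 3.\<close>

lemma lpow_7: "lpow 7 = center"
  and lpow_6: "lpow 6 = ucs 2"
  and dim_lpow_6: "dim (lpow 6) = 3"
proof -
  note [simp del] = lpow.simps
  have 76: "lpow 7 = subspace_prod (lpow 6) UNIV" using lpow_Suc[of 6] by simp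
  have sub: "lpow 7 \<subseteq> center" using lpow_ucs[of 7] ucs_1 by simp
  have "\<not> lpow 6 \<subseteq> center"
  proof
    assume "lpow 6 \<subseteq> center"
    hence "lpow 7 \<subseteq> {0}" unfolding 76 by (intro subspace_prod_subset) (auto simp: center_def)
    thus False using lpow_7_nonzero subspace_0[OF subspace_lpow[of 7]] by auto
  qed
  then obtain u where u: "u \<in> lpow 6" "u \<notin> center" by auto
  have "u \<in> ucs 2" using u lpow_ucs[of 6] by auto
  from center_subset_mult[OF this u(2)] have "center \<subseteq> span (range (\<lambda>v. u \<cdot> v))" .
  also have "\<dots> \<subseteq> lpow 7"
    unfolding 76 subspace_prod_def using u(1) by (intro span_mono) auto
  finally show 7: "lpow 7 = center" using sub by auto
  have d2: "dim (ucs 2) = 3" using dim_ucs[of 2] dim_lpow_3 by simp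
  have "dim (lpow 6) > 2" using dim_lpow_less[of 6] 7 dim_center_2 by simp
  moreover have sub6: "lpow 6 \<subseteq> ucs 2" using lpow_ucs[of 6] by simp
  moreover have "dim (lpow 6) \<le> 3" using fd.dim_subset[OF sub6] d2 by simp
  ultimately show "lpow 6 = ucs 2" "dim (lpow 6) = 3"
    using fd.subspace_dim_equal[OF subspace_lpow subspace_ucs sub6] d2 by auto
qed

text \<open>The case to exclude is that L^4 has dimension 5. Then one vector spans it over L^5. As
  L^5 is orthogonal to L^4 and the form is alternating, L^4 would be isotropic, hence inside Z_3,
  and L^5 would fall into Z_2 = L^6.\<close>

lemma dim_lpow_4: "dim (lpow 4) = 6"
  and dim_lpow_5: "dim (lpow 5) = 4"
  and lpow_5: "lpow 5 = ucs 3"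
  and lpow_4: "lpow 4 = ucs 4"
proof -
  note [simp del] = lpow.simps
  have d: "dim (lpow 4) < 7" "dim (lpow 5) < dim (lpow 4)" "3 < dim (lpow 5)"
    using dim_lpow_less[of 3] dim_lpow_less[of 4] dim_lpow_less[of 5] dim_lpow_3 dim_lpow_6 by auto
  have s5: "lpow 5 \<subseteq> ucs 3" and s4: "lpow 4 \<subseteq> ucs 4" using lpow_ucs[of 5] lpow_ucs[of 4] by auto
  have u3: "dim (ucs 3) + dim (lpow 4) = 10" and u4: "dim (ucs 4) + dim (lpow 5) = 10"
    using dim_ucs[of 3] dim_ucs[of 4] by auto
  have d5: "dim (lpow 5) \<le> 10 - dim (lpow 4)" using fd.dim_subset[OF s5] u3 by simp
  have ne: "dim (lpow 4) \<noteq> 5"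
  proof
    assume d4: "dim (lpow 4) = 5"
    hence d45: "dim (lpow 4) = dim (lpow 5) + 1" using d by simp
    have sub: "lpow 5 \<subseteq> lpow 4" by (rule lpow_antimono) simp
    obtain e where e: "e \<in> lpow 4" "e \<notin> lpow 5" using lpow_psubset[of 4] sub by auto
    have L4: "lpow 4 = span (insert e (lpow 5))"
      using e by (intro span_insert_eq subspace_lpow sub d45)
    have p5: "lpow 5 \<subseteq> perp (lpow 4)" using s5 by (simp add: ucs_def)
    have "insert e (lpow 5) \<subseteq> perp (insert e (lpow 5))"
    proof -
      have "form L x y = 0" if "x \<in> insert e (lpow 5)" "y \<in> insert e (lpow 5)" for x y
        using that p5 e sub perpD[of _ "lpow 4"] perpD'[of _ "lpow 4"]
        by (auto simp: form_alternating)
      thus ?thesis by (auto simp: perp_def)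
    qed
    hence "lpow 4 \<subseteq> perp (lpow 4)"
      unfolding L4 perp_span by (intro span_minimal subspace_perp)
    hence "lpow 4 \<subseteq> ucs 3" by (simp add: ucs_def)
    hence "subspace_prod (lpow 4) UNIV \<subseteq> ucs 2"
      using ucs_Suc[of _ 2] by (intro subspace_prod_subset[OF subspace_ucs]) auto
    hence "lpow 5 \<subseteq> ucs 2" using lpow_Suc[of 4] by simp
    hence "lpow 5 \<subseteq> lpow 6" using lpow_6 by simp
    thus False using fd.dim_subset[of "lpow 5" "lpow 6"] d dim_lpow_6 by simp
  qed
  thus d4: "dim (lpow 4) = 6" using d dim_lpow_4_ge by simp
  thus d5: "dim (lpow 5) = 4" using d d5 by simp
  show "lpow 5 = ucs 3" "lpow 4 = ucs 4"
    using fd.subspace_dim_equal[OF subspace_lpow subspace_ucs s5] fd.subspace_dim_equal[OF subspace_lpow subspace_ucs s4]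
      u3 u4 d4 d5 by auto
qed

end

section \<open>Symplectic frames\<close>

text \<open>Keeps the index in \<open>x 1\<close> and \<open>y 1\<close> from being rewritten to \<open>Suc 0\<close>, which would hide facts about them from the simplifier.\<close>

declare One_nat_def [simp del]

lemma ball_1_5: "(\<forall>i\<in>{1..5::nat}. P i) \<longleftrightarrow> P 1 \<and> P 2 \<and> P 3 \<and> P 4 \<and> P 5"
proof -
  have "{1..5::nat} = {1, 2, 3, 4, 5}" by auto
  thus ?thesis by simp
qed

lemma sum_1_5: "(\<Sum>i=1..5::nat. f i) = f 1 + f 2 + f 3 + f 4 + f 5" for f :: "nat \<Rightarrow> 'a::comm_monoid_add"
proof -
  have "{1..5::nat} = {1, 2, 3, 4, 5}" by auto
  thus ?thesis by (simp add: add.assoc)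
qed

lemma image_1_5: "f ` {1..5::nat} = {f 1, f 2, f 3, f 4, f 5}"
proof -
  have "{1..5::nat} = {1, 2, 3, 4, 5}" by auto
  thus ?thesis by simp
qed

context saa
begin

text \<open>Only the pairing relations of a standard basis: independence follows from them, and
  spanning follows in dimension 10, so a constructed family need only satisfy these.\<close>

definition symplectic_frame :: "(nat \<Rightarrow> 'v) \<Rightarrow> (nat \<Rightarrow> 'v) \<Rightarrow> bool" where
  "symplectic_frame x y \<longleftrightarrow>
     (\<forall>i\<in>{1..5}. \<forall>j\<in>{1..5}.
        form L (x i) (x j) = 0 \<and> form L (y i) (y j) = 0 \<and>
        form L (x i) (y j) = (if i = j then 1 else 0))"

lemma symplectic_frameD:
  assumes "symplectic_frame x y" "i \<in> {1..5}" "j \<in> {1..5}"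
  shows "form L (x i) (x j) = 0" "form L (y i) (y j) = 0"
    "form L (x i) (y j) = (if i = j then 1 else 0)" "form L (y i) (x j) = (if i = j then -1 else 0)"
  using assms form_skew[of "y i" "x j"] by (auto simp: symplectic_frame_def)

lemma symplectic_frame_basis:
  assumes "symplectic_frame x y"
  shows "inj_on x {1..5}" "inj_on y {1..5}" "x ` {1..5} \<inter> y ` {1..5} = {}"
    "independent (x ` {1..5} \<union> y ` {1..5})"
proof -
  note f = symplectic_frameD[OF assms]
  show ix: "inj_on x {1..5}"
  proof (rule inj_onI)
    fix i j :: nat assume ij: "i \<in> {1..5}" "j \<in> {1..5}" "x i = x j"
    have "(if j = i then 1 else 0) = (1 :: 'f)"
      using f(3)[OF ij(1,1)] f(3)[OF ij(2,1)] ij(3) by simp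
    thus "i = j" by (simp split: if_splits)
  qed
  show iy: "inj_on y {1..5}"
  proof (rule inj_onI)
    fix i j :: nat assume ij: "i \<in> {1..5}" "j \<in> {1..5}" "y i = y j"
    have "(if i = j then 1 else 0) = (1 :: 'f)"
      using f(3)[OF ij(1,1)] f(3)[OF ij(1,2)] ij(3) by simp
    thus "i = j" by (simp split: if_splits)
  qed
  have "x i \<noteq> y j" if "i \<in> {1..5}" "j \<in> {1..5}" for i j
    using f(3)[OF that(1,1)] f(2)[OF that(2,1)] by auto
  thus d: "x ` {1..5} \<inter> y ` {1..5} = {}" by auto
  show "independent (x ` {1..5} \<union> y ` {1..5})"
  proof (rule independent_if_scalars_zero)
    fix g b assume s: "(\<Sum>b\<in>x ` {1..5} \<union> y ` {1..5}. g b \<odot> b) = 0" and b: "b \<in> x ` {1..5} \<union> y ` {1..5}"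
    have s': "(\<Sum>i=1..5. g (x i) \<odot> x i) + (\<Sum>i=1..5. g (y i) \<odot> y i) = 0"
      using s d ix iy by (simp add: sum.union_disjoint sum.reindex)
    have "g (x j) = 0 \<and> g (y j) = 0" if j: "j \<in> {1..5}" for j
    proof -
      have "form L ((\<Sum>i=1..5. g (x i) \<odot> x i) + (\<Sum>i=1..5. g (y i) \<odot> y i)) (y j) = 0"
        "form L ((\<Sum>i=1..5. g (x i) \<odot> x i) + (\<Sum>i=1..5. g (y i) \<odot> y i)) (x j) = 0"
        by (simp_all only: s' form_zero_left)
      moreover have "(\<Sum>i=1..5. g (x i) * form L (x i) (y j)) = (\<Sum>i=1..5. if i = j then g (x i) else 0)"
        by (rule sum.cong) (use j in \<open>auto simp: f\<close>)
      moreover have "(\<Sum>i=1..5. g (y i) * form L (y i) (x j)) = (\<Sum>i=1..5. if i = j then - g (y i) else 0)"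
        by (rule sum.cong) (use j in \<open>auto simp: f\<close>)
      moreover have "(\<Sum>i=1..5. g (y i) * form L (y i) (y j)) = 0"
        "(\<Sum>i=1..5. g (x i) * form L (x i) (x j)) = 0"
        using j by (auto simp: f intro!: sum.neutral)
      ultimately show ?thesis using j by (simp add: form_simps form_sum_left)
    qed
    thus "g b = 0" using b by auto
  qed auto
qed

lemma symplectic_frame_standard_basis:
  assumes "symplectic_frame x y" "dim (UNIV :: 'v set) = 10"
  shows "standard_basis x y"
proof -
  note b = symplectic_frame_basis[OF assms(1)]
  have "card (x ` {1..5} \<union> y ` {1..5}) = 10"
    using b by (simp add: card_Un_disjoint card_image)
  hence "span (x ` {1..5} \<union> y ` {1..5}) = UNIV"
    using fd.card_ge_dim_independent[of _ UNIV, OF _ b(4)] assms(2) by auto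
  thus ?thesis using b assms(1) by (simp add: standard_basis_def symplectic_frame_def)
qed

lemma standard_basis_frame: "standard_basis x y \<Longrightarrow> symplectic_frame x y"
  by (simp add: standard_basis_def symplectic_frame_def)

lemma standard_basis_dim:
  assumes "standard_basis x y"
  shows "dim (UNIV :: 'v set) = 10"
proof -
  note b = symplectic_frame_basis[OF standard_basis_frame[OF assms]]
  have "card (x ` {1..5} \<union> y ` {1..5}) = 10"
    using b by (simp add: card_Un_disjoint card_image)
  moreover have "span (x ` {1..5} \<union> y ` {1..5}) = UNIV" using assms by (simp add: standard_basis_def)
  ultimately show ?thesis using dim_span_eq_card_independent[OF b(4)] by simp
qed

lemma standard_basis_ext:
  assumes "standard_basis x y"
    "\<And>i. i \<in> {1..5} \<Longrightarrow> form L u (x i) = form L v (x i)"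
    "\<And>i. i \<in> {1..5} \<Longrightarrow> form L u (y i) = form L v (y i)"
  shows "u = v"
proof -
  have "subspace {z. form L (u - v) z = 0}" by (rule subspaceI) (auto simp: form_simps)
  moreover have "x ` {1..5} \<union> y ` {1..5} \<subseteq> {z. form L (u - v) z = 0}"
    using assms(2,3) by (auto simp: form_simps)
  ultimately have "span (x ` {1..5} \<union> y ` {1..5}) \<subseteq> {z. form L (u - v) z = 0}"
    by (intro span_minimal)
  hence "form L (u - v) z = 0" for z using assms(1) by (auto simp: standard_basis_def)
  hence "u - v = 0" by (rule form_nondegenerate)
  thus ?thesis by simp
qed

text \<open>The minus sign on the y part comes from (y_i, x_i) = -1.\<close>

lemma standard_basis_expand:
  assumes "standard_basis x y"
  shows "v = (\<Sum>i=1..5. form L v (y i) \<odot> x i) - (\<Sum>i=1..5. form L v (x i) \<odot> y i)"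
  by (rule standard_basis_ext[OF assms])
    (auto simp: form_simps form_sum_left symplectic_frameD[OF standard_basis_frame[OF assms]] if_distrib
       cong: if_cong)

text \<open>The dual vectors \<open>v\<close> need not be orthogonal to each other. Each pair i < j
  is repaired once, by adding the full value (v_i, v_j) times x_i to v_j; splitting the correction
  evenly would divide by 2.\<close>

lemma lagrangian_extend:
  assumes inj: "inj_on x {1..5::nat}" and ind: "independent (x ` {1..5})"
    and iso: "\<And>i j. i \<in> {1..5} \<Longrightarrow> j \<in> {1..5} \<Longrightarrow> form L (x i) (x j) = 0"
  shows "\<exists>y. symplectic_frame x y"
proof -
  obtain w where w: "\<And>b c. b \<in> x ` {1..5} \<Longrightarrow> c \<in> x ` {1..5} \<Longrightarrow> form L b (w c) = (if b = c then 1 else 0)"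
    using dual_family[OF _ ind] by (elim exE meta_impE) auto
  define v where "v = (\<lambda>i. w (x i))"
  have v: "form L (x i) (v j) = (if i = j then 1 else 0)" if "i \<in> {1..5}" "j \<in> {1..5}" for i j
    using w[of "x i" "x j"] inj that by (auto simp: v_def inj_on_def)
  have v': "form L (v j) (x i) = (if i = j then -1 else 0)" if "i \<in> {1..5}" "j \<in> {1..5}" for i j
    using v[OF that] form_skew[of "v j" "x i"] by auto
  define y where "y = (\<lambda>j. v j + (\<Sum>i=1..5. (if i < j then form L (v i) (v j) else 0) \<odot> x i))"
  have xy: "form L (x i) (y j) = (if i = j then 1 else 0)" if "i \<in> {1..5}" "j \<in> {1..5}" for i j
    using v[OF that] iso that by (simp add: y_def form_simps form_sum_right)
  have yy: "form L (y i) (y j) = 0" if ij: "i \<in> {1..5}" "j \<in> {1..5}" "i < j" for i j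
  proof -
    have 1: "form L (v i) (\<Sum>l=1..5. (if l < j then form L (v l) (v j) else 0) \<odot> x l) = - form L (v i) (v j)"
    proof -
      have "(\<Sum>l=1..5. (if l < j then form L (v l) (v j) else 0) * form L (v i) (x l)) =
        (\<Sum>l=1..5. if l = i then - form L (v i) (v j) else 0)"
        using ij by (intro sum.cong) (auto simp: v')
      thus ?thesis using ij by (simp add: form_simps form_sum_right)
    qed
    have 2: "form L (\<Sum>l=1..5. (if l < i then form L (v l) (v i) else 0) \<odot> x l) (y j) = 0"
      unfolding form_sum_left form_scale_left using ij by (intro sum.neutral) (auto simp: xy)
    show ?thesis
      using 1 2 by (simp add: y_def form_add_left) (simp add: form_add_right)
  qed
  have "form L (y i) (y j) = 0" if "i \<in> {1..5}" "j \<in> {1..5}" for i j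
    using yy[of i j] yy[of j i] that form_skew[of "y i" "y j"] form_alternating[of "y i"]
    by (cases i j rule: linorder_cases) auto
  thus ?thesis using xy iso by (intro exI[of _ y]) (simp add: symplectic_frame_def)
qed

text \<open>The convention on unlisted triples, expressed by vanishing products so that it can be
  used for rewriting before any pairing is taken.\<close>

definition nilpotent_frame :: "(nat \<Rightarrow> 'v) \<Rightarrow> (nat \<Rightarrow> 'v) \<Rightarrow> bool" where
  "nilpotent_frame x y \<longleftrightarrow> symplectic_frame x y \<and>
     (\<forall>i\<in>{1..5}. \<forall>j\<in>{1..5}. x i \<cdot> x j = 0 \<and> (j \<le> i \<longrightarrow> x i \<cdot> y j = 0))"

text \<open>The vanishing values with x_1 reflect that UL^2 is spanned by x_5, the one with x_2 that
  L^5L^2 is, and the one with y_1 that L^4L^3 is spanned by x_3 and x_5. The four nonzero values are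
  the pivots of the later normalisation.\<close>

definition adapted_frame :: "(nat \<Rightarrow> 'v) \<Rightarrow> (nat \<Rightarrow> 'v) \<Rightarrow> bool" where
  "adapted_frame x y \<longleftrightarrow> nilpotent_frame x y \<and>
     triple (x 1) (y 2) (y 3) = 0 \<and> triple (x 1) (y 2) (y 4) = 0 \<and> triple (x 1) (y 3) (y 4) = 0 \<and>
     triple (x 2) (y 3) (y 4) = 0 \<and> triple (y 1) (y 2) (y 4) = 0 \<and>
     triple (x 1) (y 2) (y 5) \<noteq> 0 \<and> triple (x 2) (y 3) (y 5) \<noteq> 0 \<and>
     triple (x 3) (y 4) (y 5) \<noteq> 0 \<and> triple (y 1) (y 2) (y 3) \<noteq> 0"

end

section \<open>Construction of an adapted frame\<close>

locale saa_special = saa_class_7 L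
  for L :: "('f::field, 'v::ab_group_add) saa_data" (structure) +
  assumes prod_4_3_neq: "subspace_prod (lpow 4) (lpow 3) \<noteq> lpow 7"
    and prod_5_2_subset: "subspace_prod (lpow 5) (lpow 2) \<subseteq> subspace_prod (lpow 4) (lpow 3)"
    and dim_U_prod: "dim (subspace_prod U_ideal (lpow 2)) = 1"
begin

declare lpow.simps [simp del]

lemma mult_5_3: "v \<in> lpow 5 \<Longrightarrow> w \<in> lpow 3 \<Longrightarrow> v \<cdot> w = 0"
  using mult_ucs_lpow[of v 3 w] by (simp add: lpow_5)

lemma mult_6_2: "v \<in> lpow 6 \<Longrightarrow> w \<in> lpow 2 \<Longrightarrow> v \<cdot> w = 0"
  using mult_ucs_lpow[of v 2 w] by (simp add: lpow_6)

lemma mult_4_4: "v \<in> lpow 4 \<Longrightarrow> w \<in> lpow 4 \<Longrightarrow> v \<cdot> w = 0"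
  using mult_ucs_lpow[of v 4 w] by (simp add: lpow_4)

lemma mult_center: "v \<in> center \<Longrightarrow> v \<cdot> w = 0"
  by (simp add: center_def)

text \<open>Converse of \<open>mult_ucs_lpow\<close>: (uz, v) = (vu, z), so whatever annihilates L^n
  is orthogonal to L^nL.\<close>

lemma annihilator_lpow:
  assumes "\<And>w. w \<in> lpow n \<Longrightarrow> v \<cdot> w = 0" "n \<ge> 1"
  shows "v \<in> ucs n"
proof -
  have "v \<in> perp {u \<cdot> z | u z. u \<in> lpow n \<and> z \<in> UNIV}"
  proof (rule perpI)
    fix p assume "p \<in> {u \<cdot> z | u z. u \<in> lpow n \<and> z \<in> UNIV}"
    then obtain u z where p: "p = u \<cdot> z" "u \<in> lpow n" by blast
    have "triple u z v = triple v u z" by (simp add: triple_cyclic[of v u z])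
    thus "form L p v = 0" using assms(1)[OF p(2)] by (simp add: p form_zero_left)
  qed
  thus ?thesis using lpow_Suc[OF assms(2)] by (simp add: ucs_def subspace_prod_def perp_span)
qed

lemma subspace_center: "subspace center"
  using subspace_lpow[of 7] by (simp add: lpow_7)

lemma center_eq_perp: "center = perp (lpow 2)"
  using ucs_1 by (simp add: ucs_def)

lemma perp_center: "perp center = lpow 2"
  using perp_ucs[of 1] ucs_1 by simp

lemma lpow_perp: "lpow 4 = perp (lpow 5)" "lpow 3 = perp (lpow 6)" "lpow 2 = perp center"
  "lpow 5 = perp (lpow 4)" "lpow 6 = perp (lpow 3)"
  using perp_ucs[of 3] perp_ucs[of 2] lpow_5 lpow_6
  by (simp_all add: ucs_def perp_center)

text \<open>The key is an element d of L^3 outside L^4: multiplication by it identifies L^4/L^5 with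
  L^4L^3. It yields a vector e with ed spanning L^5L^2 and a vector f with fd not central, and both
  products become frame vectors.\<close>

lemma adapted_frame_ex: "\<exists>x y. adapted_frame x y"
proof -
  have sub: "lpow 3 \<subseteq> lpow 2" "lpow 4 \<subseteq> lpow 3" "lpow 5 \<subseteq> lpow 4" "lpow 6 \<subseteq> lpow 5" "center \<subseteq> lpow 6"
    using lpow_antimono[of 2 3] lpow_antimono[of 3 4] lpow_antimono[of 4 5] lpow_antimono[of 5 6]
      lpow_antimono[of 6 7] lpow_7 by auto
  \<comment> \<open>Otherwise L^5 would annihilate L^2 and so lie in Z_2 = L^6.\<close>
  have "\<exists>v\<in>lpow 5. \<exists>w\<in>lpow 2. v \<cdot> w \<noteq> 0"
  proof (rule ccontr)
    assume "\<not> ?thesis"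
    hence "lpow 5 \<subseteq> lpow 6" using annihilator_lpow[of 2] lpow_6 by auto
    thus False using lpow_psubset[of 5] sub(4) by simp
  qed
  then obtain v w where v: "v \<in> lpow 5" and w: "w \<in> lpow 2" and vw: "v \<cdot> w \<noteq> 0" by blast
  define z where "z = v \<cdot> w"
  have v6: "v \<notin> lpow 6" and w3: "w \<notin> lpow 3" using vw v w mult_6_2 mult_5_3 by auto
  have L2: "lpow 2 = span (insert w (lpow 3))"
    using w w3 sub dim_lpow_2 dim_lpow_3 by (intro span_insert_eq subspace_lpow) auto
  have L5: "lpow 5 = span (insert v (lpow 6))"
    using v v6 sub dim_lpow_5 dim_lpow_6 by (intro span_insert_eq subspace_lpow) auto
  \<comment> \<open>Because L^6L^2 = L^5L^3 = 0, the product only depends on the components along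
    \<open>v\<close> and \<open>w\<close>.\<close>
  have vz: "v' \<cdot> w' \<in> span {z}" if v'5: "v' \<in> lpow 5" and w'2: "w' \<in> lpow 2" for v' w'
  proof -
    obtain k s where v': "s \<in> lpow 6" "v' = k \<odot> v + s"
      using v'5 unfolding L5 by (elim in_span_insertE[OF _ subspace_lpow])
    obtain l t where w': "t \<in> lpow 3" "w' = l \<odot> w + t"
      using w'2 unfolding L2 by (elim in_span_insertE[OF _ subspace_lpow])
    have "v' \<cdot> w' = k \<odot> (v \<cdot> w')" using mult_6_2[OF v'(1) w'2] by (simp add: v'(2) mult_simps)
    also have "\<dots> = (k * l) \<odot> z" using mult_5_3[OF v w'(1)] by (simp add: w'(2) mult_simps z_def)
    finally show ?thesis by (simp add: span_scale span_base)
  qed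
  have z0: "z \<noteq> 0" using vw by (simp add: z_def)
  \<comment> \<open>Here (vw, w) = 0 by alternation, and (vw, t) = -(vt, w) = 0 for t in
    L^3.\<close>
  have z_center: "z \<in> center"
    unfolding center_eq_perp
  proof (rule perpI)
    fix u assume "u \<in> lpow 2"
    then obtain l t where u: "t \<in> lpow 3" "u = l \<odot> w + t"
      unfolding L2 by (elim in_span_insertE[OF _ subspace_lpow])
    have "triple v w t = 0" using mult_5_3[OF v u(1)] triple_swap23[of v w t] by (simp add: form_zero_left)
    hence "form L z u = 0" by (simp add: u z_def form_simps triple_same)
    thus "form L u z = 0" using form_skew[of u z] by simp
  qed
  obtain d where d: "d \<in> lpow 3" "d \<notin> lpow 4" using lpow_psubset[of 3] sub by auto
  have L3: "lpow 3 = span (insert d (lpow 4))"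
    using d sub dim_lpow_3 dim_lpow_4 by (intro span_insert_eq subspace_lpow) auto
  \<comment> \<open>L^4 annihilates itself, so an element of L^3 acts on L^4 through its component
    along \<open>d\<close>.\<close>
  have gd: "\<exists>k. g \<cdot> h = (k \<odot> g) \<cdot> d" if g: "g \<in> lpow 4" and h: "h \<in> lpow 3" for g h
  proof -
    obtain k s where h': "s \<in> lpow 4" "h = k \<odot> d + s"
      using h unfolding L3 by (elim in_span_insertE[OF _ subspace_lpow])
    have "g \<cdot> h = (k \<odot> g) \<cdot> d" using mult_4_4[OF g h'(1)] by (simp add: h' mult_simps)
    thus ?thesis by blast
  qed
  have W: "subspace_prod (lpow 4) (lpow 3) = (\<lambda>g. g \<cdot> d) ` lpow 4"
  proof
    have "subspace ((\<lambda>g. g \<cdot> d) ` lpow 4)"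
    proof (rule subspaceI)
      show "0 \<in> (\<lambda>g. g \<cdot> d) ` lpow 4"
        using subspace_0[OF subspace_lpow] mult_zero_left by force
      show "p + q \<in> (\<lambda>g. g \<cdot> d) ` lpow 4" if "p \<in> (\<lambda>g. g \<cdot> d) ` lpow 4" "q \<in> (\<lambda>g. g \<cdot> d) ` lpow 4" for p q
      proof -
        obtain g h where "p = g \<cdot> d" "q = h \<cdot> d" "g \<in> lpow 4" "h \<in> lpow 4" using \<open>p \<in> _\<close> \<open>q \<in> _\<close> by blast
        thus ?thesis by (intro image_eqI[of _ _ "g + h"]) (auto simp: mult_simps subspace_add[OF subspace_lpow])
      qed
      show "c \<odot> p \<in> (\<lambda>g. g \<cdot> d) ` lpow 4" if "p \<in> (\<lambda>g. g \<cdot> d) ` lpow 4" for c p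
      proof -
        obtain g where "p = g \<cdot> d" "g \<in> lpow 4" using \<open>p \<in> _\<close> by blast
        thus ?thesis by (intro image_eqI[of _ _ "c \<odot> g"]) (auto simp: mult_simps subspace_scale[OF subspace_lpow])
      qed
    qed
    moreover have "g \<cdot> h \<in> (\<lambda>g. g \<cdot> d) ` lpow 4" if "g \<in> lpow 4" "h \<in> lpow 3" for g h
      using gd[OF that] subspace_scale[OF subspace_lpow that(1)] by auto
    ultimately show "subspace_prod (lpow 4) (lpow 3) \<subseteq> (\<lambda>g. g \<cdot> d) ` lpow 4"
      by (rule subspace_prod_subset)
    show "(\<lambda>g. g \<cdot> d) ` lpow 4 \<subseteq> subspace_prod (lpow 4) (lpow 3)"
      using d by (auto intro: mult_in_subspace_prod)
  qed
  \<comment> \<open>On L^4 an element killed by \<open>d\<close> is killed by all of L^3, and the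
    annihilator of L^3 is Z_3 = L^5.\<close>
  have ker: "g \<in> lpow 5" if g: "g \<in> lpow 4" "g \<cdot> d = 0" for g
  proof -
    have "g \<cdot> h = 0" if "h \<in> lpow 3" for h
      using gd[OF g(1) that] g(2) by (auto simp: mult_simps)
    thus ?thesis using annihilator_lpow[of 3 g] by (simp add: lpow_5)
  qed
  have "z \<in> subspace_prod (lpow 4) (lpow 3)"
    using prod_5_2_subset mult_in_subspace_prod[OF v w] by (auto simp: z_def)
  then obtain e where e: "e \<in> lpow 4" "e \<cdot> d = z" unfolding W by auto
  have e5: "e \<notin> lpow 5" using e z0 mult_5_3[of e d] d by auto
  \<comment> \<open>The elements of L^4 that \<open>d\<close> maps into the line of
    \<open>z\<close>: a subspace of dimension 5 between L^5 and L^4.\<close>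
  define A where "A = span (insert e (lpow 5))"
  have A: "subspace A" "dim A = 5" "A \<subseteq> lpow 4"
    using e5 e(1) sub dim_lpow_5 span_minimal[OF _ subspace_lpow[of 4], of "insert e (lpow 5)"]
    by (auto simp: A_def fd.dim_insert span_of_subspace[OF subspace_lpow])
  have Ad: "g \<cdot> d \<in> span {z}" if gA: "g \<in> A" for g
  proof -
    obtain k s where g: "s \<in> lpow 5" "g = k \<odot> e + s"
      using gA unfolding A_def by (elim in_span_insertE[OF _ subspace_lpow])
    thus ?thesis using e(2) mult_5_3[OF g(1) d(1)] by (auto simp: mult_simps intro: span_scale span_base)
  qed
  \<comment> \<open>Inside the center, L^4L^3 would contain two independent vectors and hence be the
    whole center, that is L^7.\<close>
  have "\<not> subspace_prod (lpow 4) (lpow 3) \<subseteq> center"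
  proof
    assume Wc: "subspace_prod (lpow 4) (lpow 3) \<subseteq> center"
    have "A \<noteq> lpow 4" using A(2) dim_lpow_4 by auto
    then obtain f where f: "f \<in> lpow 4" "f \<notin> A" using A(3) by blast
    have "f \<cdot> d \<notin> span {z}"
    proof
      assume "f \<cdot> d \<in> span {z}"
      then obtain k where "f \<cdot> d = k \<odot> z" by (auto simp: span_singleton)
      hence "(f - k \<odot> e) \<cdot> d = 0" using e by (simp add: mult_simps)
      hence "f - k \<odot> e \<in> lpow 5" using f e
        by (intro ker subspace_diff[OF subspace_lpow] subspace_scale[OF subspace_lpow])
      hence "k \<odot> e + (f - k \<odot> e) \<in> A" unfolding A_def by (intro span_insertI span_base)
      thus False using f(2) by simp
    qed
    hence "independent {f \<cdot> d, z}" "f \<cdot> d \<noteq> z" using z0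
      by (auto simp: independent_insert intro: span_base)
    moreover have "{f \<cdot> d, z} \<subseteq> subspace_prod (lpow 4) (lpow 3)"
      using W f(1) e by auto
    ultimately have "2 \<le> dim (subspace_prod (lpow 4) (lpow 3))"
      using fd.independent_card_le_dim[of "{f \<cdot> d, z}"] by fastforce
    hence "subspace_prod (lpow 4) (lpow 3) = center"
      using dim_center_2 by (intro fd.subspace_dim_equal subspace_subspace_prod subspace_center Wc) simp
    thus False using prod_4_3_neq lpow_7 by simp
  qed
  then obtain f where f: "f \<in> lpow 4" "f \<cdot> d \<notin> center" unfolding W by auto
  have fA: "f \<notin> A"
  proof
    assume "f \<in> A"
    hence "f \<cdot> d \<in> span {z}" by (rule Ad)
    moreover have "span {z} \<subseteq> center" using z_center by (intro span_minimal subspace_center) auto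
    ultimately show False using f(2) by auto
  qed
  have L4: "lpow 4 = span (insert f A)"
    using A f fA dim_lpow_4 by (intro span_insert_eq subspace_lpow) auto
  have W_span: "subspace_prod (lpow 4) (lpow 3) \<subseteq> span {f \<cdot> d, z}"
  proof -
    have "g \<cdot> d \<in> span {f \<cdot> d, z}" if g4: "g \<in> lpow 4" for g
    proof -
      obtain k s where g: "s \<in> A" "g = k \<odot> f + s"
        using g4 unfolding L4 by (elim in_span_insertE[OF _ A(1)])
      show ?thesis unfolding g(2) mult_add_left mult_scale_left
        using Ad[OF g(1)] by (intro span_insertI)
    qed
    thus ?thesis unfolding W by auto
  qed
  \<comment> \<open>L^6 is the complement of L^3, and both (gd, d) = 0 and (gd, t) = -(gt, d) = 0
    for t in L^4.\<close>
  have W6: "g \<cdot> d \<in> lpow 6" if g: "g \<in> lpow 4" for g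
    unfolding lpow_perp(5)
  proof (rule perpI)
    fix u assume "u \<in> lpow 3"
    then obtain l t where u: "t \<in> lpow 4" "u = l \<odot> d + t"
      unfolding L3 by (elim in_span_insertE[OF _ subspace_lpow])
    have "triple g d t = 0" using mult_4_4[OF g u(1)] triple_swap23[of g d t] by (simp add: form_zero_left)
    hence "form L (g \<cdot> d) u = 0" by (simp add: u form_simps triple_same)
    thus "form L u (g \<cdot> d) = 0" using form_skew[of u] by simp
  qed
  have "\<exists>q\<in>center. q \<notin> span {z}"
  proof (rule ccontr)
    assume "\<not> ?thesis"
    hence "center \<subseteq> span {z}" by blast
    from dim_le_card[OF this] show False using dim_center_2 by simp
  qed
  then obtain q where q: "q \<in> center" "q \<notin> span {z}" by blast
  have Z: "center = span {q, z}"
  proof -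
    have "span {z} \<subseteq> center" using z_center by (intro span_minimal subspace_center) auto
    hence "center = span (insert q (span {z}))"
      using q z0 dim_center_2 by (intro span_insert_eq subspace_center subspace_span) auto
    thus ?thesis by (simp only: span_insert_span)
  qed
  have L6: "lpow 6 = span {f \<cdot> d, q, z}"
  proof -
    have "lpow 6 = span (insert (f \<cdot> d) center)"
      using W6 f sub dim_lpow_6 dim_center_2 by (intro span_insert_eq subspace_center subspace_lpow) auto
    thus ?thesis by (simp only: Z span_insert_span)
  qed
  have L5': "lpow 5 = span {v, f \<cdot> d, q, z}"
    using L5 by (simp only: L6 span_insert_span)
  \<comment> \<open>Ordered so that x_5 spans L^5L^2, x_4 completes the center, x_3 completes L^6,
    x_2 completes L^5, and x_1 lies in U outside L^5.\<close>
  define x where "x = (\<lambda>i::nat. if i = 1 then e else if i = 2 then v else if i = 3 then f \<cdot> d else if i = 4 then q else z)"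
  have xs: "x 1 = e" "x 2 = v" "x 3 = f \<cdot> d" "x 4 = q" "x 5 = z" by (simp_all add: x_def)
  have q0: "q \<noteq> z" using q(2) span_base[of z "{z}"] by auto
  have n3: "f \<cdot> d \<notin> span {q, z}" using f(2) Z by simp
  have n2: "v \<notin> span {f \<cdot> d, q, z}" using v6 L6 by simp
  have n1: "e \<notin> span {v, f \<cdot> d, q, z}" using e5 L5' by simp
  have ind: "independent {e, v, f \<cdot> d, q, z}"
    using n1 n2 n3 q z0 by (intro independent_insertI independent_empty) auto
  have "e \<notin> {v, f \<cdot> d, q, z}" "v \<notin> {f \<cdot> d, q, z}" "f \<cdot> d \<notin> {q, z}"
    using contra_subsetD[OF span_superset n1] contra_subsetD[OF span_superset n2]
      contra_subsetD[OF span_superset n3] by simp_all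
  hence "card {e, v, f \<cdot> d, q, z} = 5" using q0 by simp
  hence inj: "inj_on x {1..5}" by (intro eq_card_imp_inj_on) (simp_all add: image_1_5 xs)
  have mem: "v \<in> lpow 5" "f \<cdot> d \<in> lpow 5" "q \<in> lpow 5" "z \<in> lpow 5"
    using v W6[OF f(1)] q z_center sub by auto
  hence mem4: "e \<in> lpow 4" "v \<in> lpow 4" "f \<cdot> d \<in> lpow 4" "q \<in> lpow 4" "z \<in> lpow 4"
    using e sub by auto
  have f45: "form L g h = 0" "form L h g = 0" if "g \<in> lpow 4" "h \<in> lpow 5" for g h
    using that perpD[of h "lpow 4" g] perpD'[of h "lpow 4" g] lpow_perp(4) by auto
  \<comment> \<open>All of these vectors except \<open>e\<close> lie in L^5, which is orthogonal to
    L^4; and (e, e) = 0.\<close>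
  have "\<forall>i\<in>{1..5}. \<forall>j\<in>{1..5}. form L (x i) (x j) = 0"
    unfolding ball_1_5 xs using mem mem4 f45 by (simp add: form_alternating)
  with lagrangian_extend[OF inj] ind obtain y where y: "symplectic_frame x y"
    by (auto simp: image_1_5 xs)
  note fy = symplectic_frameD[OF y]
  \<comment> \<open>Each y_i is orthogonal to all x_j with j > i, so it lies in the complement of
    what those x_j span: the center here, then L^6 and L^5.\<close>
  have y123: "y i \<in> lpow 2" if "i \<in> {1..3}" for i
    unfolding lpow_perp(3) Z perp_span
    using fy(3)[of 4 i] fy(3)[of 5 i] that by (auto simp: perp_def xs)
  have y12: "y i \<in> lpow 3" if "i \<in> {1..2}" for i
    unfolding lpow_perp(2) L6 perp_span
    using fy(3)[of 3 i] fy(3)[of 4 i] fy(3)[of 5 i] that by (auto simp: perp_def xs)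
  have y1: "y 1 \<in> lpow 4"
    unfolding lpow_perp(1) L5' perp_span
    using fy(3)[of 2 1] fy(3)[of 3 1] fy(3)[of 4 1] fy(3)[of 5 1] by (auto simp: perp_def xs)
  note bas = symplectic_frame_standard_basis[OF y dim_UNIV_10]
  note expand = standard_basis_expand[OF bas, unfolded sum_1_5 xs]
  have nil: "nilpotent_frame x y"
    unfolding nilpotent_frame_def ball_1_5 xs
    using y q z_center mult_center mem mem4 mult_4_4 mult_5_3 mult_6_2 W6[OF f(1)] y1 y12[of 1] y12[of 2] y123[of 1] y123[of 2] y123[of 3] e v
    by auto
  have L52: "subspace_prod (lpow 5) (lpow 2) = span {z}"
  proof
    show "subspace_prod (lpow 5) (lpow 2) \<subseteq> span {z}"
      using vz by (intro subspace_prod_subset subspace_span)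
    show "span {z} \<subseteq> subspace_prod (lpow 5) (lpow 2)"
      using mult_in_subspace_prod[OF v w] by (intro span_minimal subspace_subspace_prod) (auto simp: z_def)
  qed
  have "subspace_prod (lpow 5) (lpow 2) \<noteq> {0}" using L52 z0 span_base[of z "{z}"] by auto
  \<comment> \<open>L^5L^2 is nonzero and contained in L^4L^3, so already the first ideal meets
    it.\<close>
  hence Ui: "U_index = 1"
    unfolding U_index_def using prod_5_2_subset
    by (intro Least_equality) (auto simp: I_ideal_def Int_absorb2)
  have U: "U_ideal = {x \<in> lpow 4. (\<lambda>y. x \<cdot> y) ` lpow 3 \<subseteq> span {z}}"
    by (simp add: U_ideal_def Ui I_ideal_def L52)
  have eU: "e \<in> U_ideal"
    unfolding U using e gd[OF e(1)] by (force simp: mult_simps intro: span_scale span_base)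
  have vU: "v \<in> U_ideal"
    unfolding U using mem4 mult_5_3[OF v] by (auto simp: span_zero)
  have zU: "z \<in> subspace_prod U_ideal (lpow 2)"
    using mult_in_subspace_prod[OF vU w] by (simp add: z_def)
  \<comment> \<open>The line of \<open>z\<close> is contained in UL^2, which is 1-dimensional by
    assumption.\<close>
  have "span {z} = subspace_prod U_ideal (lpow 2)"
    using zU z0 dim_U_prod by (intro fd.subspace_dim_equal subspace_subspace_prod subspace_span span_minimal) auto
  hence ez: "e \<cdot> h \<in> span {z}" if "h \<in> lpow 2" for h
    using mult_in_subspace_prod[OF eU that] by simp
  have z4: "form L g (y 4) = 0" if "g \<in> span {z}" for g
    using that fy(3)[of 5 4] by (auto simp: span_singleton xs form_simps)
  have z3: "form L g (y 3) = 0" if "g \<in> span {z}" for g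
    using that fy(3)[of 5 3] by (auto simp: span_singleton xs form_simps)
  have z5: "g = 0" if "g \<in> span {z}" "form L g (y 5) = 0" for g
    using that fy(3)[of 5 5] by (auto simp: span_singleton xs form_simps)
  have v3: "v \<cdot> y 3 \<in> span {z}" using vz[OF v y123[of 3]] by simp
  have xx: "x i \<cdot> x j = 0" "j \<le> i \<Longrightarrow> x i \<cdot> y j = 0" if "i \<in> {1..5}" "j \<in> {1..5}" for i j
    using nil that by (auto simp: nilpotent_frame_def)
  have w45: "form L h q = 0" "form L h z = 0" if "h \<in> lpow 2" for h
    using that q z_center lpow_perp(3) perpD' by auto
  \<comment> \<open>The vector \<open>w\<close> is orthogonal to the center, so it has no component
    along y_4 and y_5; since x_2 annihilates every x_i, y_1 and y_2, the product vw is a multiple of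
    v y_3.\<close>
  have n235: "triple v (y 3) (y 5) \<noteq> 0"
  proof
    assume "triple v (y 3) (y 5) = 0"
    hence v3': "v \<cdot> y 3 = 0" using z5[OF v3] by simp
    have "v \<cdot> w = - (form L w (f \<cdot> d) \<odot> (v \<cdot> y 3))"
      using xx[of 2 1] xx[of 2 2] xx[of 2 3] xx[of 2 4] xx[of 2 5] w45[OF w]
      by (subst expand[of w]) (simp add: mult_simps xs v3')
    thus False using vw v3' by simp
  qed
  have d45: "form L d q = 0" "form L d z = 0" using w45 d sub by auto
  \<comment> \<open>With this, \<open>d\<close> has no component along y_3 either, and ed reduces to
    a multiple of e y_2.\<close>
  have d3: "form L d (f \<cdot> d) = 0" using triple_same23[of f d] form_skew[of d] by simp
  have n125: "triple e (y 2) (y 5) \<noteq> 0"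
  proof
    assume "triple e (y 2) (y 5) = 0"
    hence e2: "e \<cdot> y 2 = 0" using z5[OF ez[OF y123[of 2]]] by simp
    have "e \<cdot> d = 0"
      using xx[of 1 1] xx[of 1 2] xx[of 1 3] xx[of 1 4] xx[of 1 5] d45 d3
      by (subst expand[of d]) (simp add: mult_simps xs e2)
    thus False using e z0 by simp
  qed
  have W12: "y 1 \<cdot> y 2 \<in> span {f \<cdot> d, z}"
    using W_span mult_in_subspace_prod[OF y1 y12[of 2]] by auto
  then obtain k l where kl: "y 1 \<cdot> y 2 = k \<odot> (f \<cdot> d) + l \<odot> z"
    by (auto simp: span_breakdown_eq algebra_simps)
  \<comment> \<open>The products of x_3 with basis vectors have this value, up to sign, as their
    only possible nonzero pairing; if it vanished, x_3 would be central.\<close>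
  have n345: "triple (f \<cdot> d) (y 4) (y 5) \<noteq> 0"
  proof
    assume t: "triple (f \<cdot> d) (y 4) (y 5) = 0"
    have xz: "x 3 \<cdot> x i = 0" if "i \<in> {1..5}" for i using xx[of 3 i] that by simp
    have "(x 3 \<cdot> y 4) = 0"
    proof (rule standard_basis_ext[OF bas])
      fix i :: nat assume i: "i \<in> {1..5}"
      show "triple (x 3) (y 4) (x i) = form L 0 (x i)"
        using xz[OF i] triple_swap23[of "x 3" "y 4" "x i"] by (simp add: form_simps)
      have "i \<in> {1,2,3} \<or> i = 4 \<or> i = 5" using i by auto
      thus "triple (x 3) (y 4) (y i) = form L 0 (y i)"
        using xx(2)[of 3 i] triple_swap23[of "x 3" "y 4" "y i"] t by (auto simp: form_simps triple_same xs)
    qed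
    moreover have "(x 3 \<cdot> y 5) = 0"
    proof (rule standard_basis_ext[OF bas])
      fix i :: nat assume i: "i \<in> {1..5}"
      show "triple (x 3) (y 5) (x i) = form L 0 (x i)"
        using xz[OF i] triple_swap23[of "x 3" "y 5" "x i"] by (simp add: form_simps)
      have "i \<in> {1,2,3} \<or> i = 4 \<or> i = 5" using i by auto
      thus "triple (x 3) (y 5) (y i) = form L 0 (y i)"
        using xx(2)[of 3 i] triple_swap23[of "x 3" "y 5" "y i"] t by (auto simp: form_simps triple_same xs)
    qed
    ultimately have "x 3 \<cdot> g = 0" for g
      using xz[of 1] xz[of 2] xz[of 3] xz[of 4] xz[of 5] xx(2)[of 3 1] xx(2)[of 3 2] xx(2)[of 3 3]
      by (subst expand[of g]) (simp add: mult_simps xs)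
    thus False using f(2) by (simp add: center_def xs)
  qed
  \<comment> \<open>The only y component of \<open>f\<close> is along y_1, and those of
    \<open>d\<close> are along y_1 and y_2. So fd is a combination of z = ed and y_1y_2, and it
    would lie in the line of \<open>z\<close> if y_1y_2 had no component along x_3.\<close>
  have n123: "triple (y 1) (y 2) (y 3) \<noteq> 0"
  proof
    assume "triple (y 1) (y 2) (y 3) = 0"
    hence "k = 0" using fy(3)[of 3 3] fy(3)[of 5 3] by (simp add: kl form_simps xs)
    hence y12z: "y 1 \<cdot> y 2 \<in> span {z}" by (auto simp: kl intro: span_scale span_base)
    have yx: "y 1 \<cdot> x i = 0" if "i \<in> {1..5}" for i
      using xx(2)[of i 1] mult_skew[of "y 1" "x i"] that by simp
    have "y 1 \<cdot> d = - (form L d v \<odot> (y 1 \<cdot> y 2))"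
      using yx[of 1] yx[of 2] yx[of 3] yx[of 4] yx[of 5] d45 d3
      by (subst expand[of d]) (simp add: mult_simps xs mult_alternating)
    hence y1d: "y 1 \<cdot> d \<in> span {z}" using y12z by (simp add: span_neg span_scale)
    have fx: "form L f v = 0" "form L f (f \<cdot> d) = 0" "form L f q = 0" "form L f z = 0"
      using f45(1)[OF f(1)] mem by auto
    have "v \<cdot> d = 0" "(f \<cdot> d) \<cdot> d = 0" "q \<cdot> d = 0" "z \<cdot> d = 0"
      using mem mult_5_3 d(1) by auto
    hence "f \<cdot> d = form L f (y 1) \<odot> z - form L f e \<odot> (y 1 \<cdot> d)"
      by (subst (1) expand[of f]) (simp add: mult_simps fx e(2))
    hence "f \<cdot> d \<in> span {z}"
      using y1d span_base[of z "{z}"] by (auto intro!: span_diff span_scale)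
    moreover have "span {z} \<subseteq> center" using z_center by (intro span_minimal subspace_center) auto
    ultimately show False using f(2) by auto
  qed
  have "triple (y 1) (y 2) (y 4) = 0"
    using fy(3)[of 3 4] fy(3)[of 5 4] by (simp add: kl form_simps xs)
  hence "adapted_frame x y"
    unfolding adapted_frame_def xs
    using nil n235 n125 n345 n123 z3[OF ez[OF y123[of 2]]] z4[OF ez[OF y123[of 2]]] z4[OF ez[OF y123[of 3]]] z4[OF v3]
    by simp
  thus ?thesis by blast
qed

end

section \<open>Normalising a frame\<close>

context saa
begin

text \<open>Oriented for rewriting: they bring any triple of frame vectors, up to sign, to one of
  the listed values or to 0.\<close>

lemma nilpotent_frame_rules:
  assumes "nilpotent_frame x y"
  shows "i \<in> {1..5} \<Longrightarrow> j \<in> {1..5} \<Longrightarrow> x i \<cdot> x j = 0"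
    and "i \<in> {1..5} \<Longrightarrow> j \<in> {1..5} \<Longrightarrow> j \<le> i \<Longrightarrow> x i \<cdot> y j = 0"
    and "y j \<cdot> x i = - (x i \<cdot> y j)"
    and "triple (y i) (y j) (x k) = triple (x k) (y i) (y j)"
    and "triple (x i) (y j) (x k) = - triple (x i) (x k) (y j)"
    and "k < j \<Longrightarrow> triple (x i) (y j) (y k) = - triple (x i) (y k) (y j)"
    and "j < i \<Longrightarrow> triple (y i) (y j) (y k) = - triple (y j) (y i) (y k)"
    and "k < j \<Longrightarrow> triple (y i) (y j) (y k) = - triple (y i) (y k) (y j)"
  using assms
  by (simp_all only: nilpotent_frame_def triple_cyclic[of "x k" "y i" "y j"])
    (rule mult_skew triple_swap23 triple_swap12 | blast)+

lemma symplectic_frameI: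
  assumes "\<And>i j. i \<in> {1..5} \<Longrightarrow> j \<in> {1..5} \<Longrightarrow> form L (x i) (x j) = 0"
    and "\<And>i j. i \<in> {1..5} \<Longrightarrow> j \<in> {1..5} \<Longrightarrow> form L (y i) (y j) = 0"
    and "\<And>i j. i \<in> {1..5} \<Longrightarrow> j \<in> {1..5} \<Longrightarrow> form L (x i) (y j) = (if i = j then 1 else 0)"
  shows "symplectic_frame x y"
  using assms by (simp add: symplectic_frame_def)

text \<open>The two changes compensate each other in the form. Because p < q, each vector is altered
  by one deeper in its flag, so the vanishing products persist.\<close>

lemma nilpotent_frame_shear:
  assumes nf: "nilpotent_frame x y" and pq: "p \<in> {1..5}" "q \<in> {1..5}" "p < q"
  shows "nilpotent_frame (x(p := x p - t \<odot> x q)) (y(q := y q + t \<odot> y p))"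
proof -
  have sf: "symplectic_frame x y" using nf by (simp add: nilpotent_frame_def)
  note f = symplectic_frameD[OF sf]
  have "symplectic_frame (x(p := x p - t \<odot> x q)) (y(q := y q + t \<odot> y p))"
    by (rule symplectic_frameI) (use pq f in \<open>auto simp: form_simps\<close>)
  thus ?thesis
    unfolding nilpotent_frame_def
    using pq nilpotent_frame_rules(1,2)[OF nf] by (auto simp: mult_simps)
qed

text \<open>The new pairings t(y_p, x_p) and t(x_q, y_q) cancel, and products with the x_i do not
  change because the x_i annihilate each other.\<close>

lemma nilpotent_frame_transvection:
  assumes nf: "nilpotent_frame x y" and pq: "p \<in> {1..5}" "q \<in> {1..5}" "p \<noteq> q"
  shows "nilpotent_frame x (y(p := y p + t \<odot> x q, q := y q + t \<odot> x p))"
proof -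
  have sf: "symplectic_frame x y" using nf by (simp add: nilpotent_frame_def)
  note f = symplectic_frameD[OF sf]
  have "symplectic_frame x (y(p := y p + t \<odot> x q, q := y q + t \<odot> x p))"
    by (rule symplectic_frameI) (use pq f in \<open>auto simp: form_simps\<close>)
  thus ?thesis
    unfolding nilpotent_frame_def
    using pq nilpotent_frame_rules(1,2)[OF nf] by (auto simp: mult_simps)
qed

lemma nilpotent_frame_transvection':
  assumes nf: "nilpotent_frame x y" and p: "p \<in> {1..5}"
  shows "nilpotent_frame x (y(p := y p + t \<odot> x p))"
proof -
  have sf: "symplectic_frame x y" using nf by (simp add: nilpotent_frame_def)
  note f = symplectic_frameD[OF sf]
  have "symplectic_frame x (y(p := y p + t \<odot> x p))"
    by (rule symplectic_frameI) (use p f in \<open>auto simp: form_simps\<close>)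
  thus ?thesis
    unfolding nilpotent_frame_def
    using p nilpotent_frame_rules(1,2)[OF nf] by (auto simp: mult_simps)
qed

lemma nilpotent_frame_scale:
  assumes nf: "nilpotent_frame x y" and c: "\<And>i. i \<in> {1..5} \<Longrightarrow> c i \<noteq> 0"
  shows "nilpotent_frame (\<lambda>i. c i \<odot> x i) (\<lambda>i. inverse (c i) \<odot> y i)"
proof -
  have sf: "symplectic_frame x y" using nf by (simp add: nilpotent_frame_def)
  note f = symplectic_frameD[OF sf]
  have "symplectic_frame (\<lambda>i. c i \<odot> x i) (\<lambda>i. inverse (c i) \<odot> y i)"
    by (rule symplectic_frameI) (use c f in \<open>auto simp: form_simps\<close>)
  thus ?thesis
    unfolding nilpotent_frame_def
    using nilpotent_frame_rules(1,2)[OF nf] by (auto simp: mult_simps)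
qed

text \<open>
  The values that can be made 0, in the order in which this is done: the transformation removing
  a value neither disturbs the preceding ones nor the conditions of an adapted frame.
\<close>

definition reducible_values :: "(nat \<Rightarrow> 'v) \<Rightarrow> (nat \<Rightarrow> 'v) \<Rightarrow> 'f list" where
  "reducible_values x y =
    [triple (y 1) (y 3) (y 4), triple (x 2) (y 4) (y 5), triple (x 1) (y 3) (y 5),
     triple (x 1) (y 4) (y 5), triple (y 1) (y 2) (y 5), triple (y 1) (y 3) (y 5),
     triple (y 1) (y 4) (y 5), triple (y 2) (y 3) (y 4), triple (y 2) (y 3) (y 5),
     triple (y 2) (y 4) (y 5), triple (y 3) (y 4) (y 5)]"

definition reduced_frame :: "nat \<Rightarrow> (nat \<Rightarrow> 'v) \<Rightarrow> (nat \<Rightarrow> 'v) \<Rightarrow> bool" where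
  "reduced_frame n x y \<longleftrightarrow> adapted_frame x y \<and> set (take n (reducible_values x y)) \<subseteq> {0}"

lemmas reduced_frame_unfold = reduced_frame_def adapted_frame_def reducible_values_def

lemmas triple_expand = mult_simps form_simps triple_same mult_alternating

lemma reduced_frame_0: "adapted_frame x y \<Longrightarrow> reduced_frame 0 x y"
  by (simp add: reduced_frame_def)

lemma reduced_frame_nilpotent: "reduced_frame n x y \<Longrightarrow> nilpotent_frame x y"
  by (simp add: reduced_frame_def adapted_frame_def)

text \<open>Adding t y_2 to y_4 contributes t(y_1y_3, y_2) = -t(y_1y_2, y_3), which fixes the sign
  of \<open>t\<close>.\<close>

lemma reduced_frame_step_1:
  assumes "reduced_frame 0 x y"
  shows "\<exists>x y. reduced_frame 1 x y"
proof -
  note nf = reduced_frame_nilpotent[OF assms]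
  note vals = assms[unfolded reduced_frame_unfold, simplified take_Cons', simplified]
  obtain t where t: "t * triple (y 1) (y 2) (y 3) = triple (y 1) (y 3) (y 4)"
    using assms by (intro that[of "triple (y 1) (y 3) (y 4) / triple (y 1) (y 2) (y 3)"]) (simp add: reduced_frame_def adapted_frame_def)
  let ?x = "x(2 := x 2 - t \<odot> x 4)" and ?y = "y(4 := y 4 + t \<odot> y 2)"
  have nf': "nilpotent_frame ?x ?y" by (rule nilpotent_frame_shear[OF nf]) simp_all
  have "reduced_frame 1 ?x ?y"
    unfolding reduced_frame_unfold
    by (intro conjI nf') (simp_all add: take_Cons' triple_expand nilpotent_frame_rules[OF nf] vals t)
  thus ?thesis by blast
qed

text \<open>The accompanying change of y_3 shifts (x_1y_3, y_5) by t(x_1y_2, y_5); this is why that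
  value is cleared afterwards.\<close>

lemma reduced_frame_step_2:
  assumes "reduced_frame 1 x y"
  shows "\<exists>x y. reduced_frame 2 x y"
proof -
  note nf = reduced_frame_nilpotent[OF assms]
  note vals = assms[unfolded reduced_frame_unfold, simplified take_Cons', simplified]
  obtain t where t: "t * triple (x 3) (y 4) (y 5) = triple (x 2) (y 4) (y 5)"
    using assms by (intro that[of "triple (x 2) (y 4) (y 5) / triple (x 3) (y 4) (y 5)"]) (simp add: reduced_frame_def adapted_frame_def)
  let ?x = "x(2 := x 2 - t \<odot> x 3)" and ?y = "y(3 := y 3 + t \<odot> y 2)"
  have nf': "nilpotent_frame ?x ?y" by (rule nilpotent_frame_shear[OF nf]) simp_all
  have "reduced_frame 2 ?x ?y"
    unfolding reduced_frame_unfold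
    by (intro conjI nf') (simp_all add: take_Cons' triple_expand nilpotent_frame_rules[OF nf] vals t)
  thus ?thesis by blast
qed

text \<open>Subtracting t x_2 from x_1 leaves (x_1y_3, y_4) = 0 intact because (x_2y_3, y_4) = 0 as
  well.\<close>

lemma reduced_frame_step_3:
  assumes "reduced_frame 2 x y"
  shows "\<exists>x y. reduced_frame 3 x y"
proof -
  note nf = reduced_frame_nilpotent[OF assms]
  note vals = assms[unfolded reduced_frame_unfold, simplified take_Cons', simplified]
  obtain t where t: "t * triple (x 2) (y 3) (y 5) = triple (x 1) (y 3) (y 5)"
    using assms by (intro that[of "triple (x 1) (y 3) (y 5) / triple (x 2) (y 3) (y 5)"]) (simp add: reduced_frame_def adapted_frame_def)
  let ?x = "x(1 := x 1 - t \<odot> x 2)" and ?y = "y(2 := y 2 + t \<odot> y 1)"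
  have nf': "nilpotent_frame ?x ?y" by (rule nilpotent_frame_shear[OF nf]) simp_all
  have "reduced_frame 3 ?x ?y"
    unfolding reduced_frame_unfold
    by (intro conjI nf') (simp_all add: take_Cons' triple_expand nilpotent_frame_rules[OF nf] vals t)
  thus ?thesis by blast
qed

lemma reduced_frame_step_4:
  assumes "reduced_frame 3 x y"
  shows "\<exists>x y. reduced_frame 4 x y"
proof -
  note nf = reduced_frame_nilpotent[OF assms]
  note vals = assms[unfolded reduced_frame_unfold, simplified take_Cons', simplified]
  obtain t where t: "t * triple (x 3) (y 4) (y 5) = triple (x 1) (y 4) (y 5)"
    using assms by (intro that[of "triple (x 1) (y 4) (y 5) / triple (x 3) (y 4) (y 5)"]) (simp add: reduced_frame_def adapted_frame_def)
  let ?x = "x(1 := x 1 - t \<odot> x 3)" and ?y = "y(3 := y 3 + t \<odot> y 1)"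
  have nf': "nilpotent_frame ?x ?y" by (rule nilpotent_frame_shear[OF nf]) simp_all
  have "reduced_frame 4 ?x ?y"
    unfolding reduced_frame_unfold
    by (intro conjI nf') (simp_all add: take_Cons' triple_expand nilpotent_frame_rules[OF nf] vals t)
  thus ?thesis by blast
qed

text \<open>The pivot (x_1y_2, y_5) keeps its value since (x_1y_2, y_3) = 0.\<close>

lemma reduced_frame_step_5:
  assumes "reduced_frame 4 x y"
  shows "\<exists>x y. reduced_frame 5 x y"
proof -
  note nf = reduced_frame_nilpotent[OF assms]
  note vals = assms[unfolded reduced_frame_unfold, simplified take_Cons', simplified]
  obtain t where t: "t * triple (y 1) (y 2) (y 3) = - triple (y 1) (y 2) (y 5)"
    using assms by (intro that[of "- (triple (y 1) (y 2) (y 5) / triple (y 1) (y 2) (y 3))"]) (simp add: reduced_frame_def adapted_frame_def)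
  let ?x = "x(3 := x 3 - t \<odot> x 5)" and ?y = "y(5 := y 5 + t \<odot> y 3)"
  have nf': "nilpotent_frame ?x ?y" by (rule nilpotent_frame_shear[OF nf]) simp_all
  have "reduced_frame 5 ?x ?y"
    unfolding reduced_frame_unfold
    by (intro conjI nf') (simp_all add: take_Cons' triple_expand nilpotent_frame_rules[OF nf] vals t)
  thus ?thesis by blast
qed

lemma reduced_frame_step_6:
  assumes "reduced_frame 5 x y"
  shows "\<exists>x y. reduced_frame 6 x y"
proof -
  note nf = reduced_frame_nilpotent[OF assms]
  note vals = assms[unfolded reduced_frame_unfold, simplified take_Cons', simplified]
  obtain t where t: "t * triple (y 1) (y 2) (y 3) = triple (y 1) (y 3) (y 5)"
    using assms by (intro that[of "triple (y 1) (y 3) (y 5) / triple (y 1) (y 2) (y 3)"]) (simp add: reduced_frame_def adapted_frame_def)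
  let ?x = "x(2 := x 2 - t \<odot> x 5)" and ?y = "y(5 := y 5 + t \<odot> y 2)"
  have nf': "nilpotent_frame ?x ?y" by (rule nilpotent_frame_shear[OF nf]) simp_all
  have "reduced_frame 6 ?x ?y"
    unfolding reduced_frame_unfold
    by (intro conjI nf') (simp_all add: take_Cons' triple_expand nilpotent_frame_rules[OF nf] vals t)
  thus ?thesis by blast
qed

text \<open>The pivot (x_3y_4, y_5) involves an x, so y_1 receives a multiple of x_3 and y_3 the
  matching multiple of x_1. The latter shifts (y_2y_3, y_5) by a multiple of (x_1y_2, y_5), so that
  value has to come later.\<close>

lemma reduced_frame_step_7:
  assumes "reduced_frame 6 x y"
  shows "\<exists>x y. reduced_frame 7 x y"
proof -
  note nf = reduced_frame_nilpotent[OF assms]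
  note vals = assms[unfolded reduced_frame_unfold, simplified take_Cons', simplified]
  obtain t where t: "t * triple (x 3) (y 4) (y 5) = - triple (y 1) (y 4) (y 5)"
    using assms by (intro that[of "- (triple (y 1) (y 4) (y 5) / triple (x 3) (y 4) (y 5))"]) (simp add: reduced_frame_def adapted_frame_def)
  let ?x = "x" and ?y = "y(1 := y 1 + t \<odot> x 3, 3 := y 3 + t \<odot> x 1)"
  have nf': "nilpotent_frame ?x ?y" by (rule nilpotent_frame_transvection[OF nf]) simp_all
  have "reduced_frame 7 ?x ?y"
    unfolding reduced_frame_unfold
    by (intro conjI nf') (simp_all add: take_Cons' triple_expand nilpotent_frame_rules[OF nf] vals t)
  thus ?thesis by blast
qed

lemma reduced_frame_step_8:
  assumes "reduced_frame 7 x y"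
  shows "\<exists>x y. reduced_frame 8 x y"
proof -
  note nf = reduced_frame_nilpotent[OF assms]
  note vals = assms[unfolded reduced_frame_unfold, simplified take_Cons', simplified]
  obtain t where t: "t * triple (y 1) (y 2) (y 3) = - triple (y 2) (y 3) (y 4)"
    using assms by (intro that[of "- (triple (y 2) (y 3) (y 4) / triple (y 1) (y 2) (y 3))"]) (simp add: reduced_frame_def adapted_frame_def)
  let ?x = "x(1 := x 1 - t \<odot> x 4)" and ?y = "y(4 := y 4 + t \<odot> y 1)"
  have nf': "nilpotent_frame ?x ?y" by (rule nilpotent_frame_shear[OF nf]) simp_all
  have "reduced_frame 8 ?x ?y"
    unfolding reduced_frame_unfold
    by (intro conjI nf') (simp_all add: take_Cons' triple_expand nilpotent_frame_rules[OF nf] vals t)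
  thus ?thesis by blast
qed

lemma reduced_frame_step_9:
  assumes "reduced_frame 8 x y"
  shows "\<exists>x y. reduced_frame 9 x y"
proof -
  note nf = reduced_frame_nilpotent[OF assms]
  note vals = assms[unfolded reduced_frame_unfold, simplified take_Cons', simplified]
  obtain t where t: "t * triple (y 1) (y 2) (y 3) = - triple (y 2) (y 3) (y 5)"
    using assms by (intro that[of "- (triple (y 2) (y 3) (y 5) / triple (y 1) (y 2) (y 3))"]) (simp add: reduced_frame_def adapted_frame_def)
  let ?x = "x(1 := x 1 - t \<odot> x 5)" and ?y = "y(5 := y 5 + t \<odot> y 1)"
  have nf': "nilpotent_frame ?x ?y" by (rule nilpotent_frame_shear[OF nf]) simp_all
  have "reduced_frame 9 ?x ?y"
    unfolding reduced_frame_unfold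
    by (intro conjI nf') (simp_all add: take_Cons' triple_expand nilpotent_frame_rules[OF nf] vals t)
  thus ?thesis by blast
qed

text \<open>The matching change of y_3 by t x_2 would affect (y_3y_4, y_5) only through (x_2y_4,
  y_5), which is already 0.\<close>

lemma reduced_frame_step_10:
  assumes "reduced_frame 9 x y"
  shows "\<exists>x y. reduced_frame 10 x y"
proof -
  note nf = reduced_frame_nilpotent[OF assms]
  note vals = assms[unfolded reduced_frame_unfold, simplified take_Cons', simplified]
  obtain t where t: "t * triple (x 3) (y 4) (y 5) = - triple (y 2) (y 4) (y 5)"
    using assms by (intro that[of "- (triple (y 2) (y 4) (y 5) / triple (x 3) (y 4) (y 5))"]) (simp add: reduced_frame_def adapted_frame_def)
  let ?x = "x" and ?y = "y(2 := y 2 + t \<odot> x 3, 3 := y 3 + t \<odot> x 2)"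
  have nf': "nilpotent_frame ?x ?y" by (rule nilpotent_frame_transvection[OF nf]) simp_all
  have "reduced_frame 10 ?x ?y"
    unfolding reduced_frame_unfold
    by (intro conjI nf') (simp_all add: take_Cons' triple_expand nilpotent_frame_rules[OF nf] vals t)
  thus ?thesis by blast
qed

lemma reduced_frame_step_11:
  assumes "reduced_frame 10 x y"
  shows "\<exists>x y. reduced_frame 11 x y"
proof -
  note nf = reduced_frame_nilpotent[OF assms]
  note vals = assms[unfolded reduced_frame_unfold, simplified take_Cons', simplified]
  obtain t where t: "t * triple (x 3) (y 4) (y 5) = - triple (y 3) (y 4) (y 5)"
    using assms by (intro that[of "- (triple (y 3) (y 4) (y 5) / triple (x 3) (y 4) (y 5))"]) (simp add: reduced_frame_def adapted_frame_def)
  let ?x = "x" and ?y = "y(3 := y 3 + t \<odot> x 3)"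
  have nf': "nilpotent_frame ?x ?y" by (rule nilpotent_frame_transvection'[OF nf]) simp_all
  have "reduced_frame 11 ?x ?y"
    unfolding reduced_frame_unfold
    by (intro conjI nf') (simp_all add: take_Cons' triple_expand nilpotent_frame_rules[OF nf] vals t)
  thus ?thesis by blast
qed

lemma reduced_frame_ex:
  assumes "adapted_frame x y"
  shows "\<exists>x y. reduced_frame 11 x y"
proof -
  have "\<exists>x y. reduced_frame 0 x y" using reduced_frame_0[OF assms] by (intro exI)
  hence "\<exists>x y. reduced_frame 1 x y" by (elim exE) (rule reduced_frame_step_1)
  hence "\<exists>x y. reduced_frame 2 x y" by (elim exE) (rule reduced_frame_step_2)
  hence "\<exists>x y. reduced_frame 3 x y" by (elim exE) (rule reduced_frame_step_3)
  hence "\<exists>x y. reduced_frame 4 x y" by (elim exE) (rule reduced_frame_step_4)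
  hence "\<exists>x y. reduced_frame 5 x y" by (elim exE) (rule reduced_frame_step_5)
  hence "\<exists>x y. reduced_frame 6 x y" by (elim exE) (rule reduced_frame_step_6)
  hence "\<exists>x y. reduced_frame 7 x y" by (elim exE) (rule reduced_frame_step_7)
  hence "\<exists>x y. reduced_frame 8 x y" by (elim exE) (rule reduced_frame_step_8)
  hence "\<exists>x y. reduced_frame 9 x y" by (elim exE) (rule reduced_frame_step_9)
  hence "\<exists>x y. reduced_frame 10 x y" by (elim exE) (rule reduced_frame_step_10)
  thus ?thesis by (elim exE) (rule reduced_frame_step_11)
qed

end

section \<open>Normalised frames, presentations and rescaling\<close>

context saa
begin

text \<open>All twenty values are written out, so that each of them is available as a rewrite rule
  without quantifiers over indices.\<close>

definition P10_frame :: "'f \<Rightarrow> (nat \<Rightarrow> 'v) \<Rightarrow> (nat \<Rightarrow> 'v) \<Rightarrow> bool" where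
  "P10_frame r x y \<longleftrightarrow> nilpotent_frame x y \<and>
     triple (x 1) (y 2) (y 3) = 0 \<and> triple (x 1) (y 2) (y 4) = 0 \<and> triple (x 1) (y 2) (y 5) = 1 \<and>
     triple (x 1) (y 3) (y 4) = 0 \<and> triple (x 1) (y 3) (y 5) = 0 \<and> triple (x 1) (y 4) (y 5) = 0 \<and>
     triple (x 2) (y 3) (y 4) = 0 \<and> triple (x 2) (y 3) (y 5) = r \<and> triple (x 2) (y 4) (y 5) = 0 \<and>
     triple (x 3) (y 4) (y 5) = 1 \<and>
     triple (y 1) (y 2) (y 3) = 1 \<and> triple (y 1) (y 2) (y 4) = 0 \<and> triple (y 1) (y 2) (y 5) = 0 \<and>
     triple (y 1) (y 3) (y 4) = 0 \<and> triple (y 1) (y 3) (y 5) = 0 \<and> triple (y 1) (y 4) (y 5) = 0 \<and>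
     triple (y 2) (y 3) (y 4) = 0 \<and> triple (y 2) (y 3) (y 5) = 0 \<and> triple (y 2) (y 4) (y 5) = 0 \<and>
     triple (y 3) (y 4) (y 5) = 0"

lemma P10_frame_presentation:
  assumes "standard_basis x y" "P10_frame r x y"
  shows "has_presentation_P10_2_5 r"
proof -
  have nf: "nilpotent_frame x y" using assms(2) by (simp add: P10_frame_def)
  note z = nilpotent_frame_rules(1,2)[OF nf]
  have a: "\<forall>i\<in>{1..5}. \<forall>j\<in>{1..5}. \<forall>k\<in>{1..5}. i < j \<and> j < k \<longrightarrow>
      triple (x i) (y j) (y k) = (if (i, j, k) = (2, 3, 5) then r
                else if (i, j, k) = (3, 4, 5) then 1
                else if (i, j, k) = (1, 2, 5) then 1
                else 0)"
    unfolding ball_1_5 using assms(2)[unfolded P10_frame_def] by simp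
  have b: "\<forall>i\<in>{1..5}. \<forall>j\<in>{1..5}. \<forall>k\<in>{1..5}. i < j \<and> j < k \<longrightarrow>
      triple (y i) (y j) (y k) = (if (i, j, k) = (1, 2, 3) then 1 else 0)"
    unfolding ball_1_5 using assms(2)[unfolded P10_frame_def] by simp
  show ?thesis
    unfolding has_presentation_P10_2_5_def has_presentation_def
  proof (rule exI[of _ x], rule exI[of _ y], intro conjI ballI)
    fix i j k :: nat assume ijk: "i \<in> {1..5}" "j \<in> {1..5}" "k \<in> {1..5}"
    note a' = a[THEN bspec[OF _ ijk(1)], THEN bspec[OF _ ijk(2)], THEN bspec[OF _ ijk(3)]]
    note b' = b[THEN bspec[OF _ ijk(1)], THEN bspec[OF _ ijk(2)], THEN bspec[OF _ ijk(3)]]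
    show "i < j \<and> j < k \<longrightarrow>
      triple (x i) (y j) (y k) = (if (i, j, k) = (2, 3, 5) then r
                else if (i, j, k) = (3, 4, 5) then 1
                else if (i, j, k) = (1, 2, 5) then 1
                else 0) \<and>
      triple (y i) (y j) (y k) = (if (i, j, k) = (1, 2, 3) then 1 else 0)"
      using a' b' by blast
    show "j < k \<and> j \<le> i \<longrightarrow> triple (x i) (y j) (y k) = 0"
      using z(2)[OF ijk(1,2)] by (simp add: form_zero_left)
    show "triple (x i) (x j) (y k) = 0" "triple (x i) (x j) (x k) = 0"
      using z(1)[OF ijk(1,2)] by (simp_all add: form_zero_left)
  qed (rule assms(1))
qed

text \<open>The convention only speaks of triples. By non-degeneracy, a product whose pairings with
  all basis vectors vanish is 0; the triples with k < j or k = j that it omits follow by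
  alternation.\<close>

lemma presentation_P10_frame:
  assumes "has_presentation_P10_2_5 r"
  obtains x y where "standard_basis x y" "P10_frame r x y"
proof -
  obtain x y where sb: "standard_basis x y" and
    all: "\<forall>i\<in>{1..5}. \<forall>j\<in>{1..5}. \<forall>k\<in>{1..5}.
      (i < j \<and> j < k \<longrightarrow>
        triple (x i) (y j) (y k) = (if (i, j, k) = (2, 3, 5) then r
          else if (i, j, k) = (3, 4, 5) then 1 else if (i, j, k) = (1, 2, 5) then 1 else 0) \<and>
        triple (y i) (y j) (y k) = (if (i, j, k) = (1, 2, 3) then 1 else 0)) \<and>
      (j < k \<and> j \<le> i \<longrightarrow> triple (x i) (y j) (y k) = 0) \<and>
      triple (x i) (x j) (y k) = 0 \<and> triple (x i) (x j) (x k) = 0"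
    using assms unfolding has_presentation_P10_2_5_def has_presentation_def by (elim exE conjE that)
  note all' = all[THEN bspec, THEN bspec, THEN bspec]
  have a: "triple (x i) (y j) (y k) = (if (i, j, k) = (2, 3, 5) then r
      else if (i, j, k) = (3, 4, 5) then 1 else if (i, j, k) = (1, 2, 5) then 1 else 0)"
    and b: "triple (y i) (y j) (y k) = (if (i, j, k) = (1, 2, 3) then 1 else 0)"
    if "i \<in> {1..5}" "j \<in> {1..5}" "k \<in> {1..5}" "i < j" "j < k" for i j k
    using all'[OF that(1,2,3)] that(4,5) by blast+
  have c: "triple (x i) (y j) (y k) = 0"
    if "i \<in> {1..5}" "j \<in> {1..5}" "k \<in> {1..5}" "j < k" "j \<le> i" for i j k
    using all'[OF that(1,2,3)] that(4,5) by blast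
  have d: "triple (x i) (x j) (y k) = 0 \<and> triple (x i) (x j) (x k) = 0"
    if "i \<in> {1..5}" "j \<in> {1..5}" "k \<in> {1..5}" for i j k
    using all'[OF that] by blast
  have xx: "x i \<cdot> x j = 0" if "i \<in> {1..5}" "j \<in> {1..5}" for i j
    by (rule standard_basis_ext[OF sb]) (use d that in \<open>auto simp: form_zero_left\<close>)
  have xy: "x i \<cdot> y j = 0" if ij: "i \<in> {1..5}" "j \<in> {1..5}" "j \<le> i" for i j
  proof (rule standard_basis_ext[OF sb])
    fix k :: nat assume k: "k \<in> {1..5}"
    have "triple (x i) (y j) (x k) = - triple (x i) (x k) (y j)" by (rule triple_swap23)
    thus "triple (x i) (y j) (x k) = form L 0 (x k)" using d[OF ij(1) k ij(2)] by (simp add: form_zero_left)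
    have "triple (x i) (y j) (y k) = 0"
    proof (cases j k rule: linorder_cases)
      case less
      thus ?thesis using c ij k by simp
    next
      case equal
      thus ?thesis by (simp add: triple_same)
    next
      case greater
      have "triple (x i) (y j) (y k) = - triple (x i) (y k) (y j)" by (rule triple_swap23)
      thus ?thesis using c[OF ij(1) k ij(2) greater] greater ij(3) by simp
    qed
    thus "triple (x i) (y j) (y k) = form L 0 (y k)" by (simp add: form_zero_left)
  qed
  have "nilpotent_frame x y"
    using standard_basis_frame[OF sb] xx xy by (simp add: nilpotent_frame_def)
  hence "P10_frame r x y"
    unfolding P10_frame_def by (simp add: a b)
  with sb show thesis by (rule that)
qed

lemma P10_frame_scale:
  assumes P: "P10_frame r x y" and a: "a \<noteq> 0"
  shows "\<exists>x y. P10_frame (a ^ 3 * r) x y"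
proof -
  \<comment> \<open>These weights fix the three values equal to 1, since c_1 = c_2c_5, c_3 = c_4c_5
    and c_1c_2c_3 = 1, while c_2/(c_3c_5) = a^3.\<close>
  define c :: "nat \<Rightarrow> 'f" where "c = (\<lambda>i. if i = 1 \<or> i = 2 then a else if i = 5 then 1 else inverse (a ^ 2))"
  have c: "c 1 = a" "c 2 = a" "c 3 = inverse (a ^ 2)" "c 4 = inverse (a ^ 2)" "c 5 = 1"
    by (simp_all add: c_def)
  have nf: "nilpotent_frame x y" using P by (simp add: P10_frame_def)
  have "c i \<noteq> 0" for i using a by (simp add: c_def)
  hence "nilpotent_frame (\<lambda>i. c i \<odot> x i) (\<lambda>i. inverse (c i) \<odot> y i)"
    by (intro nilpotent_frame_scale[OF nf])
  hence "P10_frame (a ^ 3 * r) (\<lambda>i. c i \<odot> x i) (\<lambda>i. inverse (c i) \<odot> y i)"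
    using P a unfolding P10_frame_def
    by (simp add: c mult_simps form_simps power2_eq_square power3_eq_cube field_simps)
  thus ?thesis by blast
qed

lemma reduced_frame_P10_frame:
  assumes "reduced_frame 11 x y"
  shows "\<exists>r x y. r \<noteq> 0 \<and> P10_frame r x y"
proof -
  note vals = assms[unfolded reduced_frame_unfold, simplified take_Cons', simplified]
  let ?p = "triple (x 1) (y 2) (y 5)" and ?q = "triple (y 1) (y 2) (y 3)"
    and ?s = "triple (x 3) (y 4) (y 5)"
  \<comment> \<open>With c_2 = c_5 = 1 chosen freely, the conditions that the values ?p, ?q and ?s
    become 1 determine c_1, c_3 and c_4 in turn.\<close>
  define c :: "nat \<Rightarrow> 'f" where
    "c = (\<lambda>i. if i = 1 then inverse ?p else if i = 3 then ?p * ?q else if i = 4 then ?p * ?q * ?s else 1)"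
  have c: "c 1 = inverse ?p" "c 2 = 1" "c 3 = ?p * ?q" "c 4 = ?p * ?q * ?s" "c 5 = 1"
    by (simp_all add: c_def)
  have nz: "?p \<noteq> 0" "?q \<noteq> 0" "?s \<noteq> 0" "triple (x 2) (y 3) (y 5) \<noteq> 0" using vals by auto
  have nf: "nilpotent_frame x y" using vals by auto
  have "c i \<noteq> 0" for i using nz by (simp add: c_def)
  hence "nilpotent_frame (\<lambda>i. c i \<odot> x i) (\<lambda>i. inverse (c i) \<odot> y i)"
    by (intro nilpotent_frame_scale[OF nf])
  hence "P10_frame (triple (x 2) (y 3) (y 5) / (?p * ?q)) (\<lambda>i. c i \<odot> x i) (\<lambda>i. inverse (c i) \<odot> y i)"
    using nz unfolding P10_frame_def
    by (simp add: c mult_simps form_simps vals field_simps)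
  moreover have "triple (x 2) (y 3) (y 5) / (?p * ?q) \<noteq> 0" using nz by simp
  ultimately show ?thesis by blast
qed

lemma P10_frame_standard_basis:
  assumes "P10_frame r x y" "dim (UNIV :: 'v set) = 10"
  shows "standard_basis x y"
  using assms symplectic_frame_standard_basis by (simp add: P10_frame_def nilpotent_frame_def)

lemma has_presentation_scale:
  assumes "has_presentation_P10_2_5 r" "a \<noteq> 0"
  shows "has_presentation_P10_2_5 (a ^ 3 * r)"
proof -
  obtain x y where xy: "standard_basis x y" "P10_frame r x y"
    using assms(1) by (rule presentation_P10_frame)
  obtain x' y' where "P10_frame (a ^ 3 * r) x' y'" using P10_frame_scale[OF xy(2) assms(2)] by blast
  thus ?thesis
    using standard_basis_dim[OF xy(1)] by (blast intro: P10_frame_presentation P10_frame_standard_basis)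
qed

end

lemma (in saa_special) has_presentation_ex: "\<exists>r. r \<noteq> 0 \<and> has_presentation_P10_2_5 r"
proof -
  obtain x y where "adapted_frame x y" using adapted_frame_ex by blast
  then obtain x y where "reduced_frame 11 x y" using reduced_frame_ex by blast
  then obtain r x y where "r \<noteq> 0" "P10_frame r x y" using reduced_frame_P10_frame by blast
  thus ?thesis using dim_UNIV_10 by (blast intro: P10_frame_presentation P10_frame_standard_basis)
qed

lemma (in saa) special_presentation_ex:
  assumes "class_7_UL2_1_dimensional"
  shows "\<exists>r. r \<noteq> 0 \<and> has_presentation_P10_2_5 r"
proof -
  note a = assms[unfolded class_7_UL2_1_dimensional_def]
  have "lpow (Suc 7) = {0} \<and> lpow 7 \<noteq> {0}" using a nilpotence_class_iff[of 7] by auto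
  hence "saa_special L"
    by unfold_locales (use a in simp_all)
  thus ?thesis by (rule saa_special.has_presentation_ex)
qed

section \<open>The algebras given by the presentation\<close>

context saa
begin

lemma subspace_prod_span_subset:
  assumes "subspace C" "\<And>s t. s \<in> S \<Longrightarrow> t \<in> T \<Longrightarrow> s \<cdot> t \<in> C"
  shows "subspace_prod (span S) (span T) \<subseteq> C"
proof (rule subspace_prod_subset[OF assms(1)])
  fix a b assume a: "a \<in> span S" and b: "b \<in> span T"
  have 1: "s \<cdot> b \<in> C" if s: "s \<in> S" for s
  proof -
    have "subspace {b. s \<cdot> b \<in> C}"
      using assms(1) by (auto intro!: subspaceI simp: mult_simps subspace_0 subspace_add subspace_scale)
    moreover have "T \<subseteq> {b. s \<cdot> b \<in> C}" using assms(2) s by auto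
    ultimately have "span T \<subseteq> {b. s \<cdot> b \<in> C}" by (intro span_minimal)
    thus ?thesis using b by auto
  qed
  have "subspace {a. a \<cdot> b \<in> C}"
    using assms(1) by (auto intro!: subspaceI simp: mult_simps subspace_0 subspace_add subspace_scale)
  moreover have "S \<subseteq> {a. a \<cdot> b \<in> C}" using 1 by auto
  ultimately have "span S \<subseteq> {a. a \<cdot> b \<in> C}" by (intro span_minimal)
  thus "a \<cdot> b \<in> C" using a by auto
qed

lemma subspace_prod_span_eqI:
  assumes "\<And>s t. s \<in> S \<Longrightarrow> t \<in> T \<Longrightarrow> s \<cdot> t \<in> span C"
    and "C \<subseteq> subspace_prod (span S) (span T)"
  shows "subspace_prod (span S) (span T) = span C"
  using subspace_prod_span_subset[OF subspace_span assms(1)]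
    span_minimal[OF assms(2) subspace_subspace_prod] by blast

lemma span_form_zero: "v \<in> span S \<Longrightarrow> (\<And>s. s \<in> S \<Longrightarrow> form L s w = 0) \<Longrightarrow> form L v w = 0"
  using perp_span[of S] perpI[of S w] perpD[of w "span S" v] by simp

end

locale saa_P10 = saa L
  for L :: "('f::field, 'v::ab_group_add) saa_data" (structure) +
  fixes x y :: "nat \<Rightarrow> 'v" and r :: 'f
  assumes standard_basis: "standard_basis x y"
    and frame: "P10_frame r x y"
    and r_nonzero: "r \<noteq> 0"
begin

lemma nilpotent_frame: "nilpotent_frame x y"
  using frame by (simp add: P10_frame_def)

lemma form_basis:
  assumes "i \<in> {1..5}" "j \<in> {1..5}"
  shows "form L (x i) (x j) = 0" "form L (y i) (y j) = 0"
    "form L (x i) (y j) = (if i = j then 1 else 0)" "form L (y i) (x j) = (if i = j then -1 else 0)"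
  using symplectic_frameD[OF standard_basis_frame[OF standard_basis] assms] by blast+

lemmas xx = nilpotent_frame_rules(1)[OF nilpotent_frame]
lemmas xy_le = nilpotent_frame_rules(2)[OF nilpotent_frame]
lemmas yx = nilpotent_frame_rules(3)[OF nilpotent_frame]
lemmas expand = standard_basis_expand[OF standard_basis, unfolded sum_1_5]
lemmas triples = frame[unfolded P10_frame_def]

text \<open>The coefficient of x_k in uv is (uv, y_k) and that of y_k is -(uv, x_k), so each of the
  four nonzero triples accounts for three entries of the table.\<close>

lemma products:
  "x 1 \<cdot> y 2 = x 5" "x 1 \<cdot> y 3 = 0" "x 1 \<cdot> y 4 = 0" "x 1 \<cdot> y 5 = - x 2"
  "x 2 \<cdot> y 3 = r \<odot> x 5" "x 2 \<cdot> y 4 = 0" "x 2 \<cdot> y 5 = - (r \<odot> x 3)"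
  "x 3 \<cdot> y 4 = x 5" "x 3 \<cdot> y 5 = - x 4" "x 4 \<cdot> y 5 = 0"
  "y 1 \<cdot> y 2 = x 3" "y 1 \<cdot> y 3 = - x 2" "y 1 \<cdot> y 4 = 0" "y 1 \<cdot> y 5 = 0"
  "y 2 \<cdot> y 3 = x 1" "y 2 \<cdot> y 4 = 0" "y 2 \<cdot> y 5 = - y 1"
  "y 3 \<cdot> y 4 = 0" "y 3 \<cdot> y 5 = - (r \<odot> y 2)" "y 4 \<cdot> y 5 = - y 3"
  by (subst expand, simp add: triples nilpotent_frame_rules[OF nilpotent_frame] triple_same form_simps)+

lemma products':
  "y 2 \<cdot> y 1 = - x 3" "y 3 \<cdot> y 1 = x 2" "y 4 \<cdot> y 1 = 0" "y 5 \<cdot> y 1 = 0"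
  "y 3 \<cdot> y 2 = - x 1" "y 4 \<cdot> y 2 = 0" "y 5 \<cdot> y 2 = y 1"
  "y 4 \<cdot> y 3 = 0" "y 5 \<cdot> y 3 = r \<odot> y 2" "y 5 \<cdot> y 4 = y 3"
  by (subst mult_skew, simp add: products)+

lemmas product_table = products products' xx xy_le yx mult_alternating

lemma mult_memI:
  assumes "a \<in> A" "b \<in> B" "c = k \<odot> (a \<cdot> b)"
  shows "c \<in> subspace_prod A B"
  unfolding assms(3) using assms(1,2)
  by (intro subspace_scale subspace_subspace_prod mult_in_subspace_prod)

text \<open>The table solved for the basis vectors, giving the lower inclusions for all powers and
  products below. \<open>r_nonzero\<close> is needed to divide in the entries from x_2y_5, x_2y_3
  and y_3y_5.\<close>

lemma generation:
  "y 2 \<in> A \<Longrightarrow> y 3 \<in> B \<Longrightarrow> x 1 \<in> subspace_prod A B"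
  "y 1 \<in> A \<Longrightarrow> y 3 \<in> B \<Longrightarrow> x 2 \<in> subspace_prod A B"
  "y 1 \<in> A \<Longrightarrow> y 2 \<in> B \<Longrightarrow> x 3 \<in> subspace_prod A B"
  "x 2 \<in> A \<Longrightarrow> y 5 \<in> B \<Longrightarrow> x 3 \<in> subspace_prod A B"
  "x 3 \<in> A \<Longrightarrow> y 5 \<in> B \<Longrightarrow> x 4 \<in> subspace_prod A B"
  "x 3 \<in> A \<Longrightarrow> y 4 \<in> B \<Longrightarrow> x 5 \<in> subspace_prod A B"
  "x 1 \<in> A \<Longrightarrow> y 2 \<in> B \<Longrightarrow> x 5 \<in> subspace_prod A B"
  "x 2 \<in> A \<Longrightarrow> y 3 \<in> B \<Longrightarrow> x 5 \<in> subspace_prod A B"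
  "y 2 \<in> A \<Longrightarrow> y 5 \<in> B \<Longrightarrow> y 1 \<in> subspace_prod A B"
  "y 3 \<in> A \<Longrightarrow> y 5 \<in> B \<Longrightarrow> y 2 \<in> subspace_prod A B"
  "y 4 \<in> A \<Longrightarrow> y 5 \<in> B \<Longrightarrow> y 3 \<in> subspace_prod A B"
  using mult_memI[of "y 2" A "y 3" B "x 1" 1] mult_memI[of "y 1" A "y 3" B "x 2" "-1"]
    mult_memI[of "y 1" A "y 2" B "x 3" 1] mult_memI[of "x 2" A "y 5" B "x 3" "- inverse r"]
    mult_memI[of "x 3" A "y 5" B "x 4" "-1"] mult_memI[of "x 3" A "y 4" B "x 5" 1]
    mult_memI[of "x 1" A "y 2" B "x 5" 1] mult_memI[of "x 2" A "y 3" B "x 5" "inverse r"]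
    mult_memI[of "y 2" A "y 5" B "y 1" "-1"] mult_memI[of "y 3" A "y 5" B "y 2" "- inverse r"]
    mult_memI[of "y 4" A "y 5" B "y 3" "-1"]
  by (simp_all add: products r_nonzero)

abbreviation E :: "'v set" where
  "E \<equiv> {x 1, x 2, x 3, x 4, x 5, y 1, y 2, y 3, y 4, y 5}"

lemma span_E: "UNIV = span E"
proof -
  have "x ` {1..5} \<union> y ` {1..5} = E" unfolding image_1_5 by auto
  thus ?thesis using standard_basis by (simp add: standard_basis_def)
qed

lemmas span_intros = span_zero span_neg span_scale span_base

lemma lpow_1: "lpow 1 = span E"
  unfolding lpow_one by (rule span_E)

lemma lpow_step:
  assumes "lpow n = span S" "1 \<le> n"
    and "\<And>s t. s \<in> S \<Longrightarrow> t \<in> E \<Longrightarrow> s \<cdot> t \<in> span C"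
    and "C \<subseteq> subspace_prod (span S) UNIV"
  shows "lpow (Suc n) = span C"
  using subspace_prod_span_eqI[OF assms(3)] assms(1,2,4) lpow_Suc[of n]
  by (simp only: span_E[symmetric])

lemma lpow_2: "lpow 2 = span {x 1, x 2, x 3, x 4, x 5, y 1, y 2, y 3}"
proof -
  have "lpow (Suc 1) = span {x 1, x 2, x 3, x 4, x 5, y 1, y 2, y 3}"
  proof (rule lpow_step[OF lpow_1])
    show "s \<cdot> t \<in> span {x 1, x 2, x 3, x 4, x 5, y 1, y 2, y 3}" if "s \<in> E" "t \<in> E" for s t
      using that by (elim insertE emptyE) (simp_all add: product_table span_intros)
    show "{x 1, x 2, x 3, x 4, x 5, y 1, y 2, y 3} \<subseteq> subspace_prod (span E) UNIV"
      by (simp add: generation span_base)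
  qed simp
  thus ?thesis by simp
qed

lemma lpow_3: "lpow 3 = span {x 1, x 2, x 3, x 4, x 5, y 1, y 2}"
proof -
  have "lpow (Suc 2) = span {x 1, x 2, x 3, x 4, x 5, y 1, y 2}"
  proof (rule lpow_step[OF lpow_2])
    show "s \<cdot> t \<in> span {x 1, x 2, x 3, x 4, x 5, y 1, y 2}"
      if "s \<in> {x 1, x 2, x 3, x 4, x 5, y 1, y 2, y 3}" "t \<in> E" for s t
      using that by (elim insertE emptyE) (simp_all add: product_table span_intros)
    show "{x 1, x 2, x 3, x 4, x 5, y 1, y 2} \<subseteq> subspace_prod (span {x 1, x 2, x 3, x 4, x 5, y 1, y 2, y 3}) UNIV"
      by (simp add: generation span_base)
  qed simp
  thus ?thesis by simp
qed

lemma lpow_4: "lpow 4 = span {x 1, x 2, x 3, x 4, x 5, y 1}"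
proof -
  have "lpow (Suc 3) = span {x 1, x 2, x 3, x 4, x 5, y 1}"
  proof (rule lpow_step[OF lpow_3])
    show "s \<cdot> t \<in> span {x 1, x 2, x 3, x 4, x 5, y 1}"
      if "s \<in> {x 1, x 2, x 3, x 4, x 5, y 1, y 2}" "t \<in> E" for s t
      using that by (elim insertE emptyE) (simp_all add: product_table span_intros)
    show "{x 1, x 2, x 3, x 4, x 5, y 1} \<subseteq> subspace_prod (span {x 1, x 2, x 3, x 4, x 5, y 1, y 2}) UNIV"
      by (simp add: generation span_base)
  qed simp
  thus ?thesis by simp
qed

lemma lpow_5: "lpow 5 = span {x 2, x 3, x 4, x 5}"
proof -
  have "lpow (Suc 4) = span {x 2, x 3, x 4, x 5}"
  proof (rule lpow_step[OF lpow_4])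
    show "s \<cdot> t \<in> span {x 2, x 3, x 4, x 5}"
      if "s \<in> {x 1, x 2, x 3, x 4, x 5, y 1}" "t \<in> E" for s t
      using that by (elim insertE emptyE) (simp_all add: product_table span_intros)
    show "{x 2, x 3, x 4, x 5} \<subseteq> subspace_prod (span {x 1, x 2, x 3, x 4, x 5, y 1}) UNIV"
      by (simp add: generation span_base)
  qed simp
  thus ?thesis by simp
qed

lemma lpow_6: "lpow 6 = span {x 3, x 4, x 5}"
proof -
  have "lpow (Suc 5) = span {x 3, x 4, x 5}"
  proof (rule lpow_step[OF lpow_5])
    show "s \<cdot> t \<in> span {x 3, x 4, x 5}" if "s \<in> {x 2, x 3, x 4, x 5}" "t \<in> E" for s t
      using that by (elim insertE emptyE) (simp_all add: product_table span_intros)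
    show "{x 3, x 4, x 5} \<subseteq> subspace_prod (span {x 2, x 3, x 4, x 5}) UNIV"
      by (simp add: generation span_base)
  qed simp
  thus ?thesis by simp
qed

lemma lpow_7: "lpow 7 = span {x 4, x 5}"
proof -
  have "lpow (Suc 6) = span {x 4, x 5}"
  proof (rule lpow_step[OF lpow_6])
    show "s \<cdot> t \<in> span {x 4, x 5}" if "s \<in> {x 3, x 4, x 5}" "t \<in> E" for s t
      using that by (elim insertE emptyE) (simp_all add: product_table span_intros)
    show "{x 4, x 5} \<subseteq> subspace_prod (span {x 3, x 4, x 5}) UNIV"
      by (simp add: generation span_base)
  qed simp
  thus ?thesis by simp
qed

lemma lpow_8: "lpow 8 = {0}"
proof -
  have "lpow (Suc 7) = span {}"
  proof (rule lpow_step[OF lpow_7])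
    show "s \<cdot> t \<in> span {}" if "s \<in> {x 4, x 5}" "t \<in> E" for s t
      using that by (elim insertE emptyE) (simp_all add: product_table)
  qed simp_all
  thus ?thesis by simp
qed

lemma prod_4_3: "subspace_prod (lpow 4) (lpow 3) = span {x 3, x 5}"
  unfolding lpow_4 lpow_3
proof (rule subspace_prod_span_eqI)
  show "s \<cdot> t \<in> span {x 3, x 5}"
    if "s \<in> {x 1, x 2, x 3, x 4, x 5, y 1}" "t \<in> {x 1, x 2, x 3, x 4, x 5, y 1, y 2}" for s t
    using that by (elim insertE emptyE) (simp_all add: product_table span_intros)
qed (simp add: generation span_base)

lemma prod_5_2: "subspace_prod (lpow 5) (lpow 2) = span {x 5}"
  unfolding lpow_5 lpow_2
proof (rule subspace_prod_span_eqI)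
  show "s \<cdot> t \<in> span {x 5}"
    if "s \<in> {x 2, x 3, x 4, x 5}" "t \<in> {x 1, x 2, x 3, x 4, x 5, y 1, y 2, y 3}" for s t
    using that by (elim insertE emptyE) (simp_all add: product_table span_intros)
qed (simp add: generation span_base)

lemma basis_nonzero: "i \<in> {1..5} \<Longrightarrow> x i \<noteq> 0"
  using form_basis(3)[of i i] form_zero_left by auto

lemma U_index_eq: "U_index = 1"
proof -
  have "x 5 \<in> span {x 5} \<inter> span {x 3, x 5}" by (simp add: span_base)
  moreover have "x 5 \<noteq> 0" by (simp add: basis_nonzero)
  ultimately have "I_ideal 1 \<inter> subspace_prod (lpow 4) (lpow 3) \<noteq> {0}"
    unfolding prod_4_3 by (auto simp: I_ideal_def prod_5_2)
  thus ?thesis unfolding U_index_def by (intro Least_equality) auto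
qed

text \<open>Among the spanning vectors of L^4 only y_1 is in question. As y_1y_2 = x_3 is not in the
  line of x_5, an element of U has no component along y_1.\<close>

lemma U_ideal_eq: "U_ideal = span {x 1, x 2, x 3, x 4, x 5}"
proof -
  have U: "U_ideal = {a \<in> lpow 4. (\<lambda>b. a \<cdot> b) ` lpow 3 \<subseteq> span {x 5}}"
    by (simp add: U_ideal_def U_index_eq I_ideal_def prod_5_2)
  show ?thesis
  proof
    show "span {x 1, x 2, x 3, x 4, x 5} \<subseteq> U_ideal"
    proof
      fix a assume a: "a \<in> span {x 1, x 2, x 3, x 4, x 5}"
      have "span {x 1, x 2, x 3, x 4, x 5} \<subseteq> lpow 4"
        unfolding lpow_4 by (rule span_mono) auto
      moreover have "subspace_prod (span {x 1, x 2, x 3, x 4, x 5}) (lpow 3) \<subseteq> span {x 5}"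
        unfolding lpow_3
      proof (rule subspace_prod_span_subset[OF subspace_span])
        show "s \<cdot> t \<in> span {x 5}"
          if "s \<in> {x 1, x 2, x 3, x 4, x 5}" "t \<in> {x 1, x 2, x 3, x 4, x 5, y 1, y 2}" for s t
          using that by (elim insertE emptyE) (simp_all add: product_table span_intros)
      qed
      ultimately show "a \<in> U_ideal" using a mult_in_subspace_prod[OF a] by (auto simp: U)
    qed
    show "U_ideal \<subseteq> span {x 1, x 2, x 3, x 4, x 5}"
    proof
      fix a assume "a \<in> U_ideal"
      hence a4: "a \<in> lpow 4" and a3: "a \<cdot> b \<in> span {x 5}" if "b \<in> lpow 3" for b
        using that by (auto simp: U)
      have "a \<in> span {y 1, x 1, x 2, x 3, x 4, x 5}"
        \<comment> \<open>Both \<open>a4\<close> and \<open>a3\<close> carry the premise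
          \<open>b \<in> lpow 3\<close>; the zero vector discharges it.\<close>
        using a4[of 0] subspace_0[OF subspace_lpow] by (simp add: lpow_4 insert_commute)
      then obtain k where k: "a - k \<odot> y 1 \<in> span {x 1, x 2, x 3, x 4, x 5}"
        by (auto simp: span_breakdown_eq[of a "y 1"])
      have "subspace_prod (span {x 1, x 2, x 3, x 4, x 5}) (span {y 2}) \<subseteq> span {x 5}"
        by (rule subspace_prod_span_subset[OF subspace_span]) (auto simp: product_table span_intros)
      hence "(a - k \<odot> y 1) \<cdot> y 2 \<in> span {x 5}"
        using mult_in_subspace_prod[OF k, of "y 2" "span {y 2}"] by (auto simp: span_base)
      moreover have "a \<cdot> y 2 \<in> span {x 5}" by (rule a3) (simp add: lpow_3 span_base)
      ultimately have "a \<cdot> y 2 - (a - k \<odot> y 1) \<cdot> y 2 \<in> span {x 5}" by (intro span_diff)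
      hence "k \<odot> x 3 \<in> span {x 5}" by (simp add: mult_simps products)
      hence "form L (k \<odot> x 3) (y 3) = 0" by (rule span_form_zero) (simp add: form_basis)
      hence "k = 0" by (simp add: form_simps form_basis)
      thus "a \<in> span {x 1, x 2, x 3, x 4, x 5}" using k by simp
    qed
  qed
qed

lemma prod_U_2: "subspace_prod U_ideal (lpow 2) = span {x 5}"
  unfolding U_ideal_eq lpow_2
proof (rule subspace_prod_span_eqI)
  show "s \<cdot> t \<in> span {x 5}"
    if "s \<in> {x 1, x 2, x 3, x 4, x 5}" "t \<in> {x 1, x 2, x 3, x 4, x 5, y 1, y 2, y 3}" for s t
    using that by (elim insertE emptyE) (simp_all add: product_table span_intros)
qed (simp add: generation span_base)

lemma center_eq: "center = span {x 4, x 5}"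
proof
  show "span {x 4, x 5} \<subseteq> center"
  proof
    fix z assume z: "z \<in> span {x 4, x 5}"
    have "subspace_prod (span {x 4, x 5}) (span E) \<subseteq> {0}"
      by (rule subspace_prod_span_subset) (auto simp: product_table)
    hence "z \<cdot> v = 0" for v
      using mult_in_subspace_prod[OF z, of v "span E"] by (auto simp: span_E[symmetric])
    thus "z \<in> center" by (simp add: center_def)
  qed
  show "center \<subseteq> span {x 4, x 5}"
  proof
    fix z assume "z \<in> center"
    hence "z \<in> perp (lpow 2)" using ucs_1 by (simp add: ucs_def)
    hence "form L z v = 0" if "v \<in> {x 1, x 2, x 3, x 4, x 5, y 1, y 2, y 3}" for v
      using that unfolding lpow_2 perp_span by (rule perpD')
    hence "z = form L z (y 4) \<odot> x 4 + form L z (y 5) \<odot> x 5"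
      by (subst expand[of z]) simp
    also have "\<dots> \<in> span {x 4, x 5}" by (intro span_add span_scale span_base) auto
    finally show "z \<in> span {x 4, x 5}" .
  qed
qed

lemma class_7_UL2: "class_7_UL2_1_dimensional"
  unfolding class_7_UL2_1_dimensional_def
proof (intro conjI)
  have "lpow 7 \<noteq> {0}"
    using span_base[of "x 4" "{x 4, x 5}"] basis_nonzero[of 4] by (auto simp: lpow_7)
  hence "nilpotent \<and> nilpotence_class = 7"
    using lpow_8 nilpotence_class_iff[of 7] by simp
  thus "nilpotent" "nilpotence_class = 7" by auto
  show "dim (UNIV :: 'v set) = 10" by (rule standard_basis_dim[OF standard_basis])
  show "isotropic center"
    unfolding isotropic_def
  proof (intro ballI)
    fix u v assume u: "u \<in> center" and v: "v \<in> center"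
    have "span {x 4, x 5} \<subseteq> perp {x 4, x 5}"
      by (intro span_minimal subspace_perp) (auto simp: perp_def form_basis)
    hence "v \<in> perp {x 4, x 5}" using v by (auto simp: center_eq)
    hence "v \<in> perp (span {x 4, x 5})" by (simp only: perp_span)
    thus "form L u v = 0" using u by (auto simp: center_eq dest: perpD)
  qed
  have "independent (x ` {1..5} \<union> y ` {1..5})" using standard_basis by (simp add: standard_basis_def)
  hence "independent {x 4, x 5}" by (rule independent_mono) (auto simp: image_1_5)
  moreover have "x 4 \<noteq> x 5" using form_basis(3)[of 4 4] form_basis(3)[of 5 4] by auto
  ultimately show "dim center = 2"
    unfolding center_eq by (simp add: dim_eq_card_independent)
  show "subspace_prod (lpow 4) (lpow 3) \<noteq> lpow 7"
  proof
    assume "subspace_prod (lpow 4) (lpow 3) = lpow 7"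
    hence "x 3 \<in> span {x 4, x 5}" unfolding prod_4_3 lpow_7 using span_base[of "x 3" "{x 3, x 5}"] by auto
    hence "form L (x 3) (y 3) = 0" by (rule span_form_zero) (auto simp: form_basis)
    thus False by (simp add: form_basis)
  qed
  show "subspace_prod (lpow 5) (lpow 2) \<subseteq> subspace_prod (lpow 4) (lpow 3)"
    unfolding prod_5_2 prod_4_3 by (rule span_mono) auto
  show "dim (subspace_prod U_ideal (lpow 2)) = 1"
    unfolding prod_U_2 using basis_nonzero[of 5] by simp
qed

end

section \<open>The isomorphism problem\<close>

lemma saa_P10I:
  assumes "saa L" "saa.standard_basis L x y" "saa.P10_frame L r x y" "r \<noteq> 0"
  shows "saa_P10 L x y r"
  using assms by (simp add: saa_P10_def saa_P10_axioms_def)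

lemma (in saa) presentation_saa_P10:
  assumes "has_presentation_P10_2_5 r" "r \<noteq> 0"
  obtains x y where "saa_P10 L x y r"
  using assms(1)
proof (rule presentation_P10_frame)
  fix x y assume "standard_basis x y" "P10_frame r x y"
  with assms(2) have "saa_P10 L x y r" by unfold_locales
  thus thesis by (rule that)
qed

text \<open>Both frames belong to the same algebra, so U and the powers are spanned by either. This
  makes the relevant part of the base change triangular, and U matters for x'_1: membership in L^4
  alone would allow a component along y_1.\<close>

lemma (in saa_P10) parameter_ratio:
  assumes "saa_P10 L x' y' s"
  shows "s / r \<in> nonzero_powers 3"
proof -
  interpret Q: saa_P10 L x' y' s by fact
  have U: "span {x 1, x 2, x 3, x 4, x 5} = span {x' 1, x' 2, x' 3, x' 4, x' 5}"
    using U_ideal_eq Q.U_ideal_eq by simp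
  note L2 = lpow_2[unfolded Q.lpow_2] and L3 = lpow_3[unfolded Q.lpow_3]
    and L4 = lpow_4[unfolded Q.lpow_4] and L5 = lpow_5[unfolded Q.lpow_5]
  have x1': "x' 1 \<in> span {x 1, x 2, x 3, x 4, x 5}" by (simp add: U span_base)
  have x2': "x' 2 \<in> span {x 2, x 3, x 4, x 5}" by (simp add: L5[symmetric] span_base)
  have y1': "y' 1 \<in> span {x 1, x 2, x 3, x 4, x 5, y 1}" by (simp add: L4[symmetric] span_base)
  have y2': "y' 2 \<in> span {x 1, x 2, x 3, x 4, x 5, y 1, y 2}" by (simp add: L3[symmetric] span_base)
  have y3': "y' 3 \<in> span {x 1, x 2, x 3, x 4, x 5, y 1, y 2, y 3}" by (simp add: L2[symmetric] span_base)
  have x1z: "form L (x' 1) (x i) = 0" if "i \<in> {1..5}" for i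
    by (rule span_form_zero[OF x1']) (use that in \<open>auto simp: form_basis\<close>)
  have x2z: "form L (x' 2) (x i) = 0" if "i \<in> {1..5}" for i
    by (rule span_form_zero[OF x2']) (use that in \<open>auto simp: form_basis\<close>)
  have x2z1: "form L (x' 2) (y 1) = 0"
    by (rule span_form_zero[OF x2']) (auto simp: form_basis)
  have y1z: "form L (y' 1) (x i) = 0" if "i \<in> {2..5}" for i
    by (rule span_form_zero[OF y1']) (use that in \<open>auto simp: form_basis\<close>)
  have y2z: "form L (y' 2) (x i) = 0" if "i \<in> {3..5}" for i
    by (rule span_form_zero[OF y2']) (use that in \<open>auto simp: form_basis\<close>)
  have y3z: "form L (y' 3) (x i) = 0" if "i \<in> {4..5}" for i
    by (rule span_form_zero[OF y3']) (use that in \<open>auto simp: form_basis\<close>)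
  note zeros = x1z x2z x2z1 y1z y2z y3z
  \<comment> \<open>Diagonal entries of the base change. Those for the y vectors carry a sign
    because the coefficient of y_i in v is -(v, x_i).\<close>
  define t1 where "t1 = form L (x' 1) (y 1)"
  define t2 where "t2 = form L (x' 2) (y 2)"
  define u1 where "u1 = - form L (y' 1) (x 1)"
  define u2 where "u2 = - form L (y' 2) (x 2)"
  define u3 where "u3 = - form L (y' 3) (x 3)"
  define u5 where "u5 = - form L (y' 5) (x 5)"
  have sk: "form L (x i) v = - form L v (x i)" "form L (y i) v = - form L v (y i)" for i v
    by (rule form_skew)+
  have "1 = form L (x' 1) (y' 1)" by (simp add: Q.form_basis)
  also have "\<dots> = t1 * u1"
    by (subst expand[of "x' 1"]) (simp add: form_simps zeros sk(1)[of _ "y' 1"] t1_def u1_def)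
  finally have e1: "t1 * u1 = 1" by simp
  have "1 = form L (x' 2) (y' 2)" by (simp add: Q.form_basis)
  also have "\<dots> = t2 * u2"
    by (subst expand[of "x' 2"]) (simp add: form_simps zeros sk(1)[of _ "y' 2"] t2_def u2_def)
  finally have e2: "t2 * u2 = 1" by simp
  have "x' 2 \<cdot> y' 3 = (t2 * u3 * r) \<odot> x 5"
    by (subst expand[of "x' 2"], subst expand[of "y' 3"])
      (simp add: mult_simps zeros product_table t2_def u3_def)
  hence "triple (x' 2) (y' 3) (y' 5) = t2 * u3 * r * u5"
    by (simp add: form_simps sk(1)[of 5] u5_def)
  hence e3: "s = t2 * u3 * u5 * r" by (simp add: Q.triples mult.commute mult.left_commute)
  have "x' 1 \<cdot> y' 2 = (t1 * u2) \<odot> x 5"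
    by (subst expand[of "x' 1"], subst expand[of "y' 2"])
      (simp add: mult_simps zeros product_table t1_def u2_def)
  hence "triple (x' 1) (y' 2) (y' 5) = t1 * u2 * u5"
    by (simp add: form_simps sk(1)[of 5] u5_def)
  hence e4: "t1 * u2 * u5 = 1" by (simp add: Q.triples)
  \<comment> \<open>The second summand comes from x_1y_2 = x_5 and disappears on pairing, since y'_3
    is orthogonal to x_5.\<close>
  have "y' 1 \<cdot> y' 2 = (u1 * u2) \<odot> x 3 + (form L (y' 1) (y 1) * u2) \<odot> x 5"
    by (subst (1) expand[of "y' 1"], subst expand[of "y' 2"])
      (simp add: mult_simps zeros product_table u1_def u2_def scale_right_diff_distrib mult.commute)
  hence "triple (y' 1) (y' 2) (y' 3) = u1 * u2 * u3"
    by (simp add: form_simps sk(1)[of _ "y' 3"] zeros u3_def)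
  hence e5: "u1 * u2 * u3 = 1" by (simp add: Q.triples)
  \<comment> \<open>As t_i and u_i are mutually inverse for i = 1, 2, \<open>e5\<close> and
    \<open>e4\<close> can be solved for u_3 and u_5, and \<open>e3\<close> then contains three
    factors t_2.\<close>
  have "u3 = t1 * t2"
    using e1 e2 e5 by (metis mult.assoc mult.commute mult.left_neutral)
  moreover have "u5 = u1 * t2"
    using e1 e2 e4 by (metis mult.assoc mult.commute mult.left_neutral)
  ultimately have "s = t2 ^ 3 * (t1 * u1) * r"
    using e3 by (simp add: power3_eq_cube)
  hence "s / r = t2 ^ 3" using e1 r_nonzero by simp
  moreover have "t2 \<noteq> 0" using e2 by auto
  ultimately show ?thesis unfolding nonzero_powers_def by blast
qed

section \<open>Transport of frames and maps between frames\<close>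

lemma saa_isomorphism_pull_back:
  fixes L :: "('f::field, 'v::ab_group_add) saa_data" and M :: "('f, 'w::ab_group_add) saa_data"
  assumes "saa L" "saa M" and iso: "saa_isomorphism L M f"
    and P: "saa.P10_frame M s x' y'"
  shows "saa.P10_frame L s (\<lambda>i. inv f (x' i)) (\<lambda>i. inv f (y' i))"
proof -
  interpret L: saa L by fact
  interpret M: saa M by fact
  have bij: "bij f" and fm: "f (mult L u v) = mult M (f u) (f v)" and ff: "form M (f u) (f v) = form L u v" for u v
    using iso by (auto simp: saa_isomorphism_def)
  have fi: "f (inv f w) = w" for w using bij by (simp add: bij_is_surj surj_f_inv_f)
  interpret f: Vector_Spaces.linear "smult L" "smult M" f
    using iso by (simp add: saa_isomorphism_def)
  have form: "form L (inv f u) (inv f v) = form M u v" for u v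
    using ff[of "inv f u" "inv f v"] by (simp add: fi)
  have triple: "form L (mult L (inv f u) (inv f v)) (inv f w) = form M (mult M u v) w" for u v w
    using ff[of "mult L (inv f u) (inv f v)" "inv f w"] by (simp add: fi fm)
  have mult0: "mult L (inv f u) (inv f v) = 0" if "mult M u v = 0" for u v
  proof -
    have "f (mult L (inv f u) (inv f v)) = f 0" using that by (simp add: fm fi f.zero)
    thus ?thesis using bij_is_inj[OF bij] by (simp only: inj_eq)
  qed
  show ?thesis
    using P unfolding M.P10_frame_def L.P10_frame_def M.nilpotent_frame_def L.nilpotent_frame_def
      M.symplectic_frame_def L.symplectic_frame_def
    by (simp add: form triple mult0)
qed

lemma (in saa_P10) span_induct_basis:
  assumes "subspace {v. P v}" "\<And>v. v \<in> E \<Longrightarrow> P v"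
  shows "P v"
proof -
  have "span E \<subseteq> {v. P v}" using assms by (intro span_minimal) auto
  thus ?thesis using span_E by auto
qed

text \<open>The map carrying one frame to another, given by the coordinates of
  \<open>standard_basis_expand\<close>; linearity is then immediate from that of the form.\<close>

definition basis_map ::
    "('f::field, 'v::ab_group_add) saa_data \<Rightarrow> (nat \<Rightarrow> 'v) \<Rightarrow> (nat \<Rightarrow> 'v) \<Rightarrow>
     ('f, 'w::ab_group_add) saa_data \<Rightarrow> (nat \<Rightarrow> 'w) \<Rightarrow> (nat \<Rightarrow> 'w) \<Rightarrow> 'v \<Rightarrow> 'w" where
  "basis_map L x y M x' y' v =
     (\<Sum>i=1..5. smult M (form L v (y i)) (x' i)) - (\<Sum>i=1..5. smult M (form L v (x i)) (y' i))"

lemma basis_map_linear: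
  assumes "saa L" "saa M"
  shows "Vector_Spaces.linear (smult L) (smult M) (basis_map L x y M x' y')"
proof -
  interpret L: saa L by fact
  interpret M: saa M by fact
  show ?thesis
    unfolding Vector_Spaces.linear_iff
    by (simp add: L.vector_space_axioms M.vector_space_axioms basis_map_def L.form_simps sum_1_5 M.scale_left_distrib
        M.scale_right_diff_distrib M.scale_right_distrib algebra_simps)
qed

lemma basis_map_basis:
  assumes "saa L" "saa M" "saa.symplectic_frame L x y" "i \<in> {1..5}"
  shows "basis_map L x y M x' y' (x i) = x' i" "basis_map L x y M x' y' (y i) = y' i"
proof -
  interpret L: saa L by fact
  interpret M: saa M by fact
  note f = L.symplectic_frameD[OF assms(3)]
  have *: "(\<Sum>j=1..5. smult M (if i = j then 1 else 0) (z j)) = z i"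
    "(\<Sum>j=1..5. smult M (if i = j then -1 else 0) (z j)) = - z i" for z :: "nat \<Rightarrow> _"
    using assms(4) by (simp_all add: if_distrib[of "\<lambda>c. smult M c _"] cong: if_cong)
  have "(\<Sum>j=1..5. smult M (form L (x i) (y j)) (x' j)) = (\<Sum>j=1..5. smult M (if i = j then 1 else 0) (x' j))"
    "(\<Sum>j=1..5. smult M (form L (y i) (x j)) (y' j)) = (\<Sum>j=1..5. smult M (if i = j then -1 else 0) (y' j))"
    by (intro sum.cong refl; use assms(4) f in simp)+
  moreover have "(\<Sum>j=1..5. smult M (form L (x i) (x j)) (y' j)) = 0"
    "(\<Sum>j=1..5. smult M (form L (y i) (y j)) (x' j)) = 0"
    using assms(4) f by (auto intro!: sum.neutral)
  ultimately show "basis_map L x y M x' y' (x i) = x' i" "basis_map L x y M x' y' (y i) = y' i"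
    by (simp_all add: basis_map_def *)
qed

text \<open>Exchanging the frames gives the inverse, because the composite is linear and fixes every
  frame vector; applied both ways it yields bijectivity.\<close>

lemma basis_map_inverse:
  assumes "saa_P10 L x y r" "saa_P10 M x' y' s"
  shows "basis_map M x' y' L x y (basis_map L x y M x' y' v) = v"
proof -
  interpret P: saa_P10 L x y r by fact
  interpret Q: saa_P10 M x' y' s by fact
  note sf = P.standard_basis_frame[OF P.standard_basis] Q.standard_basis_frame[OF Q.standard_basis]
  interpret f: Vector_Spaces.linear "smult L" "smult M" "basis_map L x y M x' y'"
    by (intro basis_map_linear P.saa_axioms Q.saa_axioms)
  interpret g: Vector_Spaces.linear "smult M" "smult L" "basis_map M x' y' L x y"
    by (intro basis_map_linear P.saa_axioms Q.saa_axioms)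
  note b = basis_map_basis[OF P.saa_axioms Q.saa_axioms sf(1)] basis_map_basis[OF Q.saa_axioms P.saa_axioms sf(2)]
  show ?thesis
  proof (rule P.span_induct_basis)
    show "P.subspace {v. basis_map M x' y' L x y (basis_map L x y M x' y' v) = v}"
      by (rule P.subspaceI) (simp_all add: f.zero g.zero f.add g.add f.scale g.scale)
  qed (auto simp: b)
qed

text \<open>Product table and pairings depend on the parameter alone, so the map between the frames
  respects them on basis vectors, and then everywhere by bilinearity.\<close>

lemma same_presentation_isomorphic:
  assumes "saa_P10 L x y r" "saa_P10 M x' y' r"
  shows "saa_isomorphic L M"
proof -
  interpret P: saa_P10 L x y r by fact
  interpret Q: saa_P10 M x' y' r by fact
  let ?f = "basis_map L x y M x' y'"
  note sf = P.standard_basis_frame[OF P.standard_basis]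
  interpret f: Vector_Spaces.linear "smult L" "smult M" ?f
    by (intro basis_map_linear P.saa_axioms Q.saa_axioms)
  note b = basis_map_basis[OF P.saa_axioms Q.saa_axioms sf]
  note fs = f.zero f.add f.scale f.neg
  have "bij ?f"
    by (rule bij_betw_byWitness[of _ "basis_map M x' y' L x y"])
      (simp_all add: basis_map_inverse[OF assms] basis_map_inverse[OF assms(2,1)])
  moreover have "?f (mult L u v) = mult M (?f u) (?f v)" for u v
  proof (rule P.span_induct_basis[of _ u])
    show "P.subspace {u. ?f (mult L u v) = mult M (?f u) (?f v)}"
      by (rule P.subspaceI) (simp_all add: fs P.mult_simps Q.mult_simps)
    fix u assume u: "u \<in> P.E"
    show "?f (mult L u v) = mult M (?f u) (?f v)"
    proof (rule P.span_induct_basis[of _ v])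
      show "P.subspace {v. ?f (mult L u v) = mult M (?f u) (?f v)}"
        by (rule P.subspaceI) (simp_all add: fs P.mult_simps Q.mult_simps)
      fix v assume "v \<in> P.E"
      thus "?f (mult L u v) = mult M (?f u) (?f v)"
        using u by (elim insertE emptyE) (simp_all add: P.product_table Q.product_table fs b)
    qed
  qed
  moreover have "form M (?f u) (?f v) = form L u v" for u v
  proof (rule P.span_induct_basis[of _ u])
    show "P.subspace {u. form M (?f u) (?f v) = form L u v}"
      by (rule P.subspaceI) (simp_all add: fs P.form_simps Q.form_simps)
    fix u assume u: "u \<in> P.E"
    show "form M (?f u) (?f v) = form L u v"
    proof (rule P.span_induct_basis[of _ v])
      show "P.subspace {v. form M (?f u) (?f v) = form L u v}"
        by (rule P.subspaceI) (simp_all add: fs P.form_simps Q.form_simps)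
      fix v assume "v \<in> P.E"
      thus "form M (?f u) (?f v) = form L u v"
        using u by (elim insertE emptyE) (simp_all add: P.form_basis Q.form_basis b)
    qed
  qed
  ultimately have "saa_isomorphism L M ?f"
    using f.linear_axioms by (simp add: saa_isomorphism_def)
  thus ?thesis by (auto simp: saa_isomorphic_def)
qed

text \<open>An isomorphism pulls the frame of \<open>M\<close> back to \<open>L\<close>, where two
  frames of one algebra can be compared. Conversely, rescaling the frame of \<open>L\<close> by a
  cube root of s/r moves its parameter to \<open>s\<close>.\<close>

lemma isomorphic_iff_cube_ratio:
  fixes L :: "('f::field, 'v::ab_group_add) saa_data" and M :: "('f, 'w::ab_group_add) saa_data"
  assumes L: "saa L" and M: "saa M" and rs: "r \<noteq> 0" "s \<noteq> 0"
    and pr: "saa.has_presentation_P10_2_5 L r" and ps: "saa.has_presentation_P10_2_5 M s"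
  shows "saa_isomorphic L M \<longleftrightarrow> s / r \<in> nonzero_powers 3"
proof
  obtain x y where P: "saa_P10 L x y r" using saa.presentation_saa_P10[OF L pr rs(1)] by blast
  obtain x' y' where Q: "saa_P10 M x' y' s" using saa.presentation_saa_P10[OF M ps rs(2)] by blast
  interpret P: saa_P10 L x y r by fact
  interpret Q: saa_P10 M x' y' s by fact
  {
    assume "saa_isomorphic L M"
    then obtain f where "saa_isomorphism L M f" by (auto simp: saa_isomorphic_def)
    from saa_isomorphism_pull_back[OF L M this Q.frame]
    have pf: "P.P10_frame s (\<lambda>i. inv f (x' i)) (\<lambda>i. inv f (y' i))" .
    moreover have "P.standard_basis (\<lambda>i. inv f (x' i)) (\<lambda>i. inv f (y' i))"
      using pf P.standard_basis_dim[OF P.standard_basis] by (rule P.P10_frame_standard_basis)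
    ultimately have "saa_P10 L (\<lambda>i. inv f (x' i)) (\<lambda>i. inv f (y' i)) s"
      using L rs by (intro saa_P10I)
    thus "s / r \<in> nonzero_powers 3" by (rule P.parameter_ratio)
  next
    assume "s / r \<in> nonzero_powers 3"
    then obtain a where a: "a \<noteq> 0" "s / r = a ^ 3" by (auto simp: nonzero_powers_def)
    hence "P.has_presentation_P10_2_5 s"
      using P.has_presentation_scale[OF pr a(1)] rs by (simp add: field_simps)
    then obtain x2 y2 where "saa_P10 L x2 y2 s" using P.presentation_saa_P10 rs(2) by blast
    thus "saa_isomorphic L M" using Q by (rule same_presentation_isomorphic)
  }
qed

section \<open>Existence\<close>

text \<open>The model is F^10 with coordinates 1 to 5 for the x vectors and 6 to 10 for the y
  vectors, the standard symplectic form, and the table of \<open>products\<close> extended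
  bilinearly.\<close>

lemma presentation_exists:
  fixes r :: "'f::field"
  shows "\<exists>L :: ('f, 'f ^ 10) saa_data. saa L \<and> saa.has_presentation_P10_2_5 L r"
proof -
  \<comment> \<open>A labelling of the index type, so that coordinates are addressed by natural
    numbers and case distinctions on them are decidable by rewriting.\<close>
  obtain e :: "nat \<Rightarrow> 10" where e: "bij_betw e {1..10} (UNIV :: 10 set)"
    using ex_bij_betw_nat_finite_1[of "UNIV :: 10 set"] by auto
  define h where "h = inv_into {1..10} e"
  have h: "h (e k) = k" if "k \<in> {1..10}" for k
    using e that by (simp add: h_def bij_betw_def)
  define mk :: "(nat \<Rightarrow> 'f) \<Rightarrow> 'f ^ 10" where "mk = (\<lambda>c. \<chi> i. c (h i))"
  have mk: "mk c $ e k = c k" if "k \<in> {1..10}" for c k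
    using h[OF that] by (simp add: mk_def)
  have eqI: "u = v" if "\<And>k. k \<in> {1..10} \<Longrightarrow> u $ e k = v $ e k" for u v :: "'f ^ 10"
  proof (rule vec_eq_iff[THEN iffD2], rule allI)
    fix i :: 10
    have "i \<in> e ` {1..10}" using e by (simp add: bij_betw_def)
    thus "u $ i = v $ i" using that by auto
  qed
  have all_1_10: "(\<forall>k\<in>{1..10::nat}. P k) \<longleftrightarrow> P 1 \<and> P 2 \<and> P 3 \<and> P 4 \<and> P 5 \<and> P 6 \<and> P 7 \<and> P 8 \<and> P 9 \<and> P 10" for P
  proof -
    have "{1..10::nat} = {1, 2, 3, 4, 5, 6, 7, 8, 9, 10}"
      by (auto simp: set_eq_iff) presburger
    thus ?thesis by simp
  qed
  define B :: "'f ^ 10 \<Rightarrow> 'f ^ 10 \<Rightarrow> 'f" where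
    "B = (\<lambda>u v. u $ e 1 * v $ e 6 - u $ e 6 * v $ e 1 + (u $ e 2 * v $ e 7 - u $ e 7 * v $ e 2)
      + (u $ e 3 * v $ e 8 - u $ e 8 * v $ e 3) + (u $ e 4 * v $ e 9 - u $ e 9 * v $ e 4)
      + (u $ e 5 * v $ e 10 - u $ e 10 * v $ e 5))"
  define D where "D = (\<lambda>i j (u :: 'f ^ 10) (v :: 'f ^ 10). u $ e i * v $ e j - u $ e j * v $ e i)"
  \<comment> \<open>Coordinate k collects the table entries containing the k-th basis vector. Each
    entry enters through a 2 by 2 minor \<open>D i j\<close>, which makes the product alternating at
    once.\<close>
  define c :: "'f ^ 10 \<Rightarrow> 'f ^ 10 \<Rightarrow> nat \<Rightarrow> 'f" where
    "c = (\<lambda>u v k.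
      if k = 1 then D 7 8 u v
      else if k = 2 then - D 1 10 u v - D 6 8 u v
      else if k = 3 then D 6 7 u v - r * D 2 10 u v
      else if k = 4 then - D 3 10 u v
      else if k = 5 then D 1 7 u v + r * D 2 8 u v + D 3 9 u v
      else if k = 6 then - D 7 10 u v
      else if k = 7 then - r * D 8 10 u v
      else if k = 8 then - D 9 10 u v
      else 0)"
  define p where "p = (\<lambda>u v. mk (c u v))"
  have p: "p u v $ e k = c u v k" if "k \<in> {1..10}" for u v k
    unfolding p_def using that by (rule mk)
  define L where "L = \<lparr>smult = (*s), form = B, mult = p\<rparr>"
  have sel: "smult L = (*s)" "form L = B" "mult L = p" by (simp_all add: L_def)
  have D_lin: "D i j (u + v) w = D i j u w + D i j v w" "D i j w (u + v) = D i j w u + D i j w v"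
    "D i j (a *s u) w = a * D i j u w" "D i j w (a *s u) = a * D i j w u" "D i j u u = 0" for i j u v w a
    by (simp_all add: D_def algebra_simps)
  have saa: "saa L"
  proof (rule saa.intro, unfold sel)
    show "vector_space ((*s) :: 'f \<Rightarrow> 'f ^ 10 \<Rightarrow> _)" by (rule vec.vector_space_axioms)
    show "\<exists>B. finite B \<and> module.span (*s) B = (UNIV :: ('f ^ 10) set)"
      using vec.finite_Basis vec.span_Basis by blast
    show "Vector_Spaces.linear (*s) (*) (\<lambda>x. B x y)" for y
      unfolding Vector_Spaces.linear_iff
      by (simp add: B_def algebra_simps vec.vector_space_axioms vector_space_over_itself.vector_space_axioms)
    show "Vector_Spaces.linear (*s) (*) (\<lambda>y. B x y)" for x
      unfolding Vector_Spaces.linear_iff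
      by (simp add: B_def algebra_simps vec.vector_space_axioms vector_space_over_itself.vector_space_axioms)
    show "B x x = 0" for x by (simp add: B_def)
    show "x = 0" if "\<And>y. B x y = 0" for x
    proof (rule eqI)
      fix k :: nat assume "k \<in> {1..10}"
      moreover have "\<forall>k\<in>{1..10}. x $ e k = 0"
        unfolding all_1_10
        using that[of "mk (\<lambda>k. if k = 1 then 1 else 0)"] that[of "mk (\<lambda>k. if k = 2 then 1 else 0)"]
          that[of "mk (\<lambda>k. if k = 3 then 1 else 0)"] that[of "mk (\<lambda>k. if k = 4 then 1 else 0)"]
          that[of "mk (\<lambda>k. if k = 5 then 1 else 0)"] that[of "mk (\<lambda>k. if k = 6 then 1 else 0)"]
          that[of "mk (\<lambda>k. if k = 7 then 1 else 0)"] that[of "mk (\<lambda>k. if k = 8 then 1 else 0)"]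
          that[of "mk (\<lambda>k. if k = 9 then 1 else 0)"] that[of "mk (\<lambda>k. if k = 10 then 1 else 0)"]
        by (simp add: B_def mk)
      ultimately show "x $ e k = 0 $ e k" by simp
    qed
    show "Vector_Spaces.linear (*s) (*s) (\<lambda>x. p x y)" for y
      unfolding Vector_Spaces.linear_iff
      by (auto intro!: eqI simp: p c_def D_lin vec.vector_space_axioms algebra_simps)
    show "Vector_Spaces.linear (*s) (*s) (\<lambda>y. p x y)" for x
      unfolding Vector_Spaces.linear_iff
      by (auto intro!: eqI simp: p c_def D_lin vec.vector_space_axioms algebra_simps)
    show "p x x = 0" for x
      by (rule eqI) (simp add: p c_def D_lin)
    show "B (p x y) z = B (p y z) x" for x y z
      by (simp add: B_def p c_def D_def algebra_simps)
  qed
  interpret saa L by (rule saa)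
  define x where "x = (\<lambda>i. mk (\<lambda>k. if k = i then 1 else 0))"
  define y where "y = (\<lambda>i. mk (\<lambda>k. if k = i + 5 then 1 else 0))"
  have sf: "symplectic_frame x y"
    unfolding symplectic_frame_def ball_1_5 sel by (simp add: B_def x_def y_def mk)
  have "nilpotent_frame x y"
    unfolding nilpotent_frame_def ball_1_5 sel
    using sf by (auto intro!: eqI simp: p c_def D_def x_def y_def mk)
  hence "P10_frame r x y"
    unfolding P10_frame_def sel
    by (simp add: B_def p c_def D_def x_def y_def mk)
  moreover have "dim (UNIV :: ('f ^ 10) set) = 10"
    unfolding sel by (subst vec_dim_card) simp
  ultimately have "has_presentation_P10_2_5 r"
    by (intro P10_frame_presentation P10_frame_standard_basis)
  thus ?thesis using saa by blast
qed

text \<open>The last clause ensures that every nonzero parameter occurs, as the others only speak of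
  algebras already given. The second allows different carrier types, so that the comparison is not
  confined to structures on one space.\<close>

theorem proposition3p5:
  shows "(\<forall>L :: ('f::field, 'v::ab_group_add) saa_data.
            saa L \<and> saa.class_7_UL2_1_dimensional L \<longrightarrow>
            (\<exists>r. r \<noteq> 0 \<and> saa.has_presentation_P10_2_5 L r)) \<and>
         (\<forall>(L :: ('f, 'v) saa_data) (M :: ('f, 'w::ab_group_add) saa_data) r s.
            saa L \<and> saa M \<and> r \<noteq> 0 \<and> s \<noteq> 0 \<and>
            saa.has_presentation_P10_2_5 L r \<and> saa.has_presentation_P10_2_5 M s \<longrightarrow>
            (saa_isomorphic L M \<longleftrightarrow> s / r \<in> nonzero_powers 3)) \<and>
         (\<forall>(L :: ('f, 'v) saa_data) r.
            saa L \<and> r \<noteq> 0 \<and> saa.has_presentation_P10_2_5 L r \<longrightarrow>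
            saa.class_7_UL2_1_dimensional L) \<and>
         (\<forall>r :: 'f. r \<noteq> 0 \<longrightarrow>
            (\<exists>L :: ('f, 'f ^ 10) saa_data. saa L \<and> saa.has_presentation_P10_2_5 L r))"
proof (intro conjI allI impI)
  fix L :: "('f, 'v) saa_data"
  assume "saa L \<and> saa.class_7_UL2_1_dimensional L"
  thus "\<exists>r. r \<noteq> 0 \<and> saa.has_presentation_P10_2_5 L r"
    using saa.special_presentation_ex by blast
next
  fix L :: "('f, 'v) saa_data" and M :: "('f, 'w) saa_data" and r s
  assume "saa L \<and> saa M \<and> r \<noteq> 0 \<and> s \<noteq> 0 \<and>
    saa.has_presentation_P10_2_5 L r \<and> saa.has_presentation_P10_2_5 M s"
  thus "saa_isomorphic L M \<longleftrightarrow> s / r \<in> nonzero_powers 3"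
    using isomorphic_iff_cube_ratio by blast
next
  fix L :: "('f, 'v) saa_data" and r
  assume "saa L \<and> r \<noteq> 0 \<and> saa.has_presentation_P10_2_5 L r"
  then obtain x y where "saa_P10 L x y r" using saa.presentation_saa_P10 by blast
  thus "saa.class_7_UL2_1_dimensional L" by (rule saa_P10.class_7_UL2)
qed (rule presentation_exists)

end
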